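(* Let $(f,g):\mathcal{C}(1)\to\mathcal{C}(2)$ be a morphism of exact couples of $R$-modules such that for $s\in\{1,2\}$ (writing $E_r^{p,q}$ for the object of the $r$-th page in position $(p,q)$): (1) the associated spectral sequences satisfy $E_r^{p,q}(s)=0$ for all $r\geq 2$ whenever $p<0$ or $q<0$; (2) for $r\geq 2$ the differential $d_r(s)$ on $E_r(s)$ has bidegree $(r,-r+1)$; (3) the $E_\infty$-objects match the limit abutment: $L^n(s)=0$ for $n<0$ and, for each $n\geq 0$, the canonical filtration of $L^n(s)$ has the form $$0=F^{n,0}(s)\subseteq F^{n-1,1}(s)\subseteq\cdots\subseteq F^{0,n}(s)\subseteq F^{-1,n+1}(s)=L^n(s),$$ with short exact sequences $0\to F^{p,q}(s)\to F^{p-1,q+1}(s)\to E_\infty^{p,q}(s)\to 0$ for $p+q=n$, compatible with the maps induced by $(f,g)$. Assume further: (i) The induced map of limit abutment objects $L^n(f):L^n(1)\to L^n(2)$ is an isomorphism for all $n\in\mathbb{Z}$. (ii) $f_2^{0,0}:E_2^{0,0}(1)\to E_2^{0,0}(2)$ is an isomorphism. (iii) For every $n\geq0$: if $f_2^{p,0}:E_2^{p,0}(1)\to E_2^{p,0}(2)$ is an isomorphism for $0\leq p\leq n$, then $f_2^{p,q}$ is an isomorphism for all $(p,q)$ with $p\leq n$ and all $q\in\mathbb{Z}$. Then the induced map $(f_r\mid r\geq 2)$ of spectral sequences is an isomorphism.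
   Context: $R$ is a unital ring. A $(\mathbb{Z}\times\mathbb{Z})$-bigraded exact couple $(E,D,i,j,k)$ with bidegrees $\mathbf{a},\mathbf{b},\mathbf{c}\in\mathbb{Z}\times\mathbb{Z}$ consists of families of $R$-modules $D_{\mathbf{x}},E_{\mathbf{x}}$ ($\mathbf{x}\in\mathbb{Z}\times\mathbb{Z}$) and $R$-linear maps $i_{\mathbf{x}}:D_{\mathbf{x}}\to D_{\mathbf{x}+\mathbf{a}}$, $j_{\mathbf{x}}:D_{\mathbf{x}}\to E_{\mathbf{x}+\mathbf{b}}$, $k_{\mathbf{x}}:E_{\mathbf{x}}\to D_{\mathbf{x}+\mathbf{c}}$ such that $D_{\mathbf{x}-\mathbf{a}}\xrightarrow{i}D_{\mathbf{x}}\xrightarrow{j}E_{\mathbf{x}+\mathbf{b}}\xrightarrow{k}D_{\mathbf{x}+\mathbf{b}+\mathbf{c}}\xrightarrow{i}D_{\mathbf{x}+\mathbf{a}+\mathbf{b}+\mathbf{c}}$ is exact for all $\mathbf{x}$. A morphism $(f,g)$ of exact couples with equal bidegrees is a pair of families $f_{\mathbf{x}}:D_{\mathbf{x}}(1)\to D_{\mathbf{x}}(2)$, $g_{\mathbf{x}}:E_{\mathbf{x}}(1)\to E_{\mathbf{x}}(2)$ commuting with $i,j,k$. Associated spectral sequence: with $i^r$ the $r$-fold composite of $i$, put $Z_{r}^{\mathbf{x}+\mathbf{b}}=k^{-1}(\operatorname{im}\,i^{r}_{\mathbf{x}+\mathbf{b}+\mathbf{c}-r\mathbf{a}})$, $B_r^{\mathbf{x}+\mathbf{b}}=j(\ker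 i^r_{\mathbf{x}})$, $E_{r+1}=Z_r/B_r$ for $r\ge 0$; $d_r$ on $E_r$ sends the class of $e$ to the class of $j(y)$ where $i^{r-1}(y)=k(e)$; it has bidegree $\mathbf{b}+\mathbf{c}-(r-1)\mathbf{a}$, and $E_{r+1}$ is the homology of $(E_r,d_r)$. $E_\infty:=\bigcap_rZ_r/\bigcup_rB_r$. A morphism of exact couples induces a morphism $f_r:E_r(1)\to E_r(2)$ of spectral sequences ($r\leq\infty$). Condition (2) forces $\mathbf{a}=(-1,1)$ and $\mathbf{b}+\mathbf{c}=(1,0)$. The limit abutment $L^n$ is the limit of the diagram $\cdots\to D_{\mathbf{x}-\mathbf{a}}\xrightarrow{i}D_{\mathbf{x}}\xrightarrow{i}D_{\mathbf{x}+\mathbf{a}}\to\cdots$ of the $D_{\mathbf{x}}$ with $\mathbf{x}=(p,q)$, $p+q=n$ (indexing by total degree); its canonical filtration is by the kernels of the cone maps $L^n\to D_{\mathbf{x}}$. A morphism of exact couples induces filtration-preserving maps $L^n(f):L^n(1)\to L^n(2)$. *)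

theory Defs
  imports "HOL-Algebra.Module" "HOL-Algebra.AbelCoset" "HOL-Library.Product_Plus"
begin

section \<open>Modules over a unital ring\<close>

text \<open>
  The library locale \<^locale>\<open>module\<close> demands a commutative ring of scalars.  Here the same axioms are
  imposed over an arbitrary unital ring, on the same record type.
\<close>

locale left_module = R?: ring R + M?: abelian_group M
  for R (structure) and M (structure) +
  assumes smult_closed:
      "\<lbrakk>a \<in> carrier R; x \<in> carrier M\<rbrakk> \<Longrightarrow> a \<odot>\<^bsub>M\<^esub> x \<in> carrier M"
    and smult_l_distr:
      "\<lbrakk>a \<in> carrier R; b \<in> carrier R; x \<in> carrier M\<rbrakk> \<Longrightarrow>
        (a \<oplus>\<^bsub>R\<^esub> b) \<odot>\<^bsub>M\<^esub> x = a \<odot>\<^bsub>M\<^esub> x \<oplus>\<^bsub>M\<^esub> b \<odot>\<^bsub>M\<^esub> x"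
    and smult_r_distr:
      "\<lbrakk>a \<in> carrier R; x \<in> carrier M; y \<in> carrier M\<rbrakk> \<Longrightarrow>
        a \<odot>\<^bsub>M\<^esub> (x \<oplus>\<^bsub>M\<^esub> y) = a \<odot>\<^bsub>M\<^esub> x \<oplus>\<^bsub>M\<^esub> a \<odot>\<^bsub>M\<^esub> y"
    and smult_assoc1:
      "\<lbrakk>a \<in> carrier R; b \<in> carrier R; x \<in> carrier M\<rbrakk> \<Longrightarrow>
        (a \<otimes>\<^bsub>R\<^esub> b) \<odot>\<^bsub>M\<^esub> x = a \<odot>\<^bsub>M\<^esub> (b \<odot>\<^bsub>M\<^esub> x)"
    and smult_one:
      "x \<in> carrier M \<Longrightarrow> \<one>\<^bsub>R\<^esub> \<odot>\<^bsub>M\<^esub> x = x"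

lemma left_module_iff_module:
  assumes "cring R"
  shows "left_module R M \<longleftrightarrow> module R M"
  using assms
  by (auto simp: left_module_def left_module_axioms_def module_def module_axioms_def cring.axioms(1))

definition lin_hom ::
  "('r, 'm) ring_scheme \<Rightarrow> ('r, 'x, 'n) module_scheme \<Rightarrow> ('r, 'y, 'k) module_scheme \<Rightarrow> ('x \<Rightarrow> 'y) set"
  where "lin_hom R M N =
    {h \<in> carrier M \<rightarrow> carrier N.
       (\<forall>x\<in>carrier M. \<forall>y\<in>carrier M. h (x \<oplus>\<^bsub>M\<^esub> y) = h x \<oplus>\<^bsub>N\<^esub> h y) \<and>
       (\<forall>r\<in>carrier R. \<forall>x\<in>carrier M. h (r \<odot>\<^bsub>M\<^esub> x) = r \<odot>\<^bsub>N\<^esub> h x)}"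

definition lin_iso ::
  "('r, 'm) ring_scheme \<Rightarrow> ('r, 'x, 'n) module_scheme \<Rightarrow> ('r, 'y, 'k) module_scheme \<Rightarrow> ('x \<Rightarrow> 'y) set"
  where "lin_iso R M N = {h \<in> lin_hom R M N. bij_betw h (carrier M) (carrier N)}"

definition zero_module :: "('r, 'x, 'n) module_scheme \<Rightarrow> bool"
  where "zero_module M \<longleftrightarrow> carrier M = {\<zero>\<^bsub>M\<^esub>}"

text \<open>
  The subquotient \<open>Z/B\<close> of \<open>M\<close>, for submodules \<open>B \<subseteq> Z\<close> of \<open>M\<close>; its elements are the cosets of \<open>B\<close>.
  The ring fields \<open>mult\<close> and \<open>one\<close> of the record play no role for modules.
\<close>

definition subquotient ::
  "('r, 'x, 'n) module_scheme \<Rightarrow> 'x set \<Rightarrow> 'x set \<Rightarrow> ('r, 'x set) module"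
  where "subquotient M Z B =
    \<lparr>carrier = {B +>\<^bsub>M\<^esub> z |z. z \<in> Z}, mult = undefined, one = undefined,
     zero = B, add = (\<lambda>X Y. X <+>\<^bsub>M\<^esub> Y),
     smult = (\<lambda>r X. the_elem ((\<lambda>e. B +>\<^bsub>M\<^esub> (r \<odot>\<^bsub>M\<^esub> e)) ` X))\<rparr>"

text \<open>
  The map \<open>[e] \<mapsto> [h e]\<close> into cosets of \<open>B\<close> in \<open>N\<close>; \<^const>\<open>the_elem\<close> extracts the class that is
  common to all representatives.
\<close>

definition class_map ::
  "('r, 'y, 'n) module_scheme \<Rightarrow> 'y set \<Rightarrow> ('x \<Rightarrow> 'y) \<Rightarrow> 'x set \<Rightarrow> 'y set"
  where "class_map N B h X = the_elem ((\<lambda>e. B +>\<^bsub>N\<^esub> h e) ` X)"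


section \<open>Exact couples\<close>

type_synonym pos = "int \<times> int"

definition zscale :: "int \<Rightarrow> pos \<Rightarrow> pos"
  where "zscale n x = (n * fst x, n * snd x)"

record ('r, 'd, 'e) couple =
  D_mod :: "pos \<Rightarrow> ('r, 'd) module"
  E_mod :: "pos \<Rightarrow> ('r, 'e) module"
  i_map :: "pos \<Rightarrow> 'd \<Rightarrow> 'd"
  j_map :: "pos \<Rightarrow> 'd \<Rightarrow> 'e"
  k_map :: "pos \<Rightarrow> 'e \<Rightarrow> 'd"
  deg_a :: pos
  deg_b :: pos
  deg_c :: pos

text \<open>All \<open>D\<^sub>x\<close> share one element type, and so do all \<open>E\<^sub>x\<close>; their carriers need not be disjoint.\<close>

definition exact_couple :: "('r, 'm) ring_scheme \<Rightarrow> ('r, 'd, 'e) couple \<Rightarrow> bool"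
  where "exact_couple R C \<longleftrightarrow>
    ring R \<and>
    (\<forall>x. left_module R (D_mod C x)) \<and>
    (\<forall>x. left_module R (E_mod C x)) \<and>
    (\<forall>x. i_map C x \<in> lin_hom R (D_mod C x) (D_mod C (x + deg_a C))) \<and>
    (\<forall>x. j_map C x \<in> lin_hom R (D_mod C x) (E_mod C (x + deg_b C))) \<and>
    (\<forall>x. k_map C x \<in> lin_hom R (E_mod C x) (D_mod C (x + deg_c C))) \<and>
    (\<forall>x. i_map C (x - deg_a C) ` carrier (D_mod C (x - deg_a C))
         = a_kernel (D_mod C x) (E_mod C (x + deg_b C)) (j_map C x)) \<and>
    (\<forall>x. j_map C x ` carrier (D_mod C x)
         = a_kernel (E_mod C (x + deg_b C)) (D_mod C (x + deg_b C + deg_c C))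
             (k_map C (x + deg_b C))) \<and>
    (\<forall>x. k_map C (x + deg_b C) ` carrier (E_mod C (x + deg_b C))
         = a_kernel (D_mod C (x + deg_b C + deg_c C))
             (D_mod C (x + deg_a C + deg_b C + deg_c C))
             (i_map C (x + deg_b C + deg_c C)))"

definition couple_morphism ::
  "('r, 'm) ring_scheme \<Rightarrow> ('r, 'd1, 'e1) couple \<Rightarrow> ('r, 'd2, 'e2) couple \<Rightarrow>
   (pos \<Rightarrow> 'd1 \<Rightarrow> 'd2) \<Rightarrow> (pos \<Rightarrow> 'e1 \<Rightarrow> 'e2) \<Rightarrow> bool"
  where "couple_morphism R C1 C2 f g \<longleftrightarrow>
    deg_a C1 = deg_a C2 \<and> deg_b C1 = deg_b C2 \<and> deg_c C1 = deg_c C2 \<and>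
    (\<forall>x. f x \<in> lin_hom R (D_mod C1 x) (D_mod C2 x)) \<and>
    (\<forall>x. g x \<in> lin_hom R (E_mod C1 x) (E_mod C2 x)) \<and>
    (\<forall>x. \<forall>u\<in>carrier (D_mod C1 x). f (x + deg_a C1) (i_map C1 x u) = i_map C2 x (f x u)) \<and>
    (\<forall>x. \<forall>u\<in>carrier (D_mod C1 x). g (x + deg_b C1) (j_map C1 x u) = j_map C2 x (f x u)) \<and>
    (\<forall>x. \<forall>e\<in>carrier (E_mod C1 x). f (x + deg_c C1) (k_map C1 x e) = k_map C2 x (g x e))"


section \<open>The associated spectral sequence\<close>

primrec i_pow :: "('r, 'd, 'e) couple \<Rightarrow> nat \<Rightarrow> pos \<Rightarrow> 'd \<Rightarrow> 'd"
  where
    "i_pow C 0 x u = u"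
  | "i_pow C (Suc r) x u = i_map C (x + zscale (int r) (deg_a C)) (i_pow C r x u)"

definition Z_sub :: "('r, 'd, 'e) couple \<Rightarrow> nat \<Rightarrow> pos \<Rightarrow> 'e set"
  where "Z_sub C r x =
    {e \<in> carrier (E_mod C x).
       k_map C x e \<in> i_pow C r (x + deg_c C - zscale (int r) (deg_a C))
                       ` carrier (D_mod C (x + deg_c C - zscale (int r) (deg_a C)))}"

definition B_sub :: "('r, 'd, 'e) couple \<Rightarrow> nat \<Rightarrow> pos \<Rightarrow> 'e set"
  where "B_sub C r x =
    j_map C (x - deg_b C)
      ` a_kernel (D_mod C (x - deg_b C)) (D_mod C (x - deg_b C + zscale (int r) (deg_a C)))
          (i_pow C r (x - deg_b C))"

text \<open>\<open>page C r x\<close> is \<open>E\<^sub>r\<close> at position \<open>x\<close>, for \<open>r \<ge> 1\<close>: \<open>E\<^sub>r\<^sub>+\<^sub>1 = Z\<^sub>r/B\<^sub>r\<close>.\<close>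

definition page :: "('r, 'd, 'e) couple \<Rightarrow> nat \<Rightarrow> pos \<Rightarrow> ('r, 'e set) module"
  where "page C r x = subquotient (E_mod C x) (Z_sub C (r - 1) x) (B_sub C (r - 1) x)"

definition E_infinity :: "('r, 'd, 'e) couple \<Rightarrow> pos \<Rightarrow> ('r, 'e set) module"
  where "E_infinity C x = subquotient (E_mod C x) (\<Inter>r. Z_sub C r x) (\<Union>r. B_sub C r x)"

definition diff_deg :: "('r, 'd, 'e) couple \<Rightarrow> nat \<Rightarrow> pos"
  where "diff_deg C r = deg_b C + deg_c C - zscale (int r - 1) (deg_a C)"

definition diff :: "('r, 'd, 'e) couple \<Rightarrow> nat \<Rightarrow> pos \<Rightarrow> 'e set \<Rightarrow> 'e set"
  where "diff C r x X =
    (let w = x + deg_c C - zscale (int r - 1) (deg_a C) in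
     the_elem {B_sub C (r - 1) (x + diff_deg C r) +>\<^bsub>E_mod C (x + diff_deg C r)\<^esub> j_map C w y
               | y e. e \<in> X \<and> y \<in> carrier (D_mod C w) \<and> i_pow C (r - 1) w y = k_map C x e})"

text \<open>
  \<open>E\<^sub>r\<^sub>+\<^sub>1\<close> as the homology of \<open>(E\<^sub>r, d\<^sub>r)\<close>: the class in \<open>E\<^sub>r\<close> of \<open>e \<in> Z\<^sub>r\<close> is a cycle, and it represents
  the class of \<open>e\<close> in \<open>E\<^sub>r\<^sub>+\<^sub>1\<close>.
\<close>

definition next_page :: "('r, 'd, 'e) couple \<Rightarrow> nat \<Rightarrow> pos \<Rightarrow> 'e set \<Rightarrow> 'e set"
  where "next_page C r x = class_map (E_mod C x) (B_sub C r x) (\<lambda>e. e)"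

definition ss_morphism ::
  "('r, 'm) ring_scheme \<Rightarrow> ('r, 'd1, 'e1) couple \<Rightarrow> ('r, 'd2, 'e2) couple \<Rightarrow>
   (nat \<Rightarrow> pos \<Rightarrow> 'e1 set \<Rightarrow> 'e2 set) \<Rightarrow> bool"
  where "ss_morphism R C1 C2 \<phi> \<longleftrightarrow>
    (\<forall>r\<ge>2. diff_deg C1 r = diff_deg C2 r) \<and>
    (\<forall>r\<ge>2. \<forall>x. \<phi> r x \<in> lin_hom R (page C1 r x) (page C2 r x)) \<and>
    (\<forall>r\<ge>2. \<forall>x. \<forall>X\<in>carrier (page C1 r x).
       \<phi> r (x + diff_deg C1 r) (diff C1 r x X) = diff C2 r x (\<phi> r x X)) \<and>
    (\<forall>r\<ge>2. \<forall>x. \<forall>X\<in>a_kernel (page C1 r x) (page C1 r (x + diff_deg C1 r)) (diff C1 r x).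
       \<phi> (Suc r) x (next_page C1 r x X) = next_page C2 r x (\<phi> r x X))"

definition ss_isomorphism ::
  "('r, 'm) ring_scheme \<Rightarrow> ('r, 'd1, 'e1) couple \<Rightarrow> ('r, 'd2, 'e2) couple \<Rightarrow>
   (nat \<Rightarrow> pos \<Rightarrow> 'e1 set \<Rightarrow> 'e2 set) \<Rightarrow> bool"
  where "ss_isomorphism R C1 C2 \<phi> \<longleftrightarrow>
    ss_morphism R C1 C2 \<phi> \<and>
    (\<forall>r\<ge>2. \<forall>x. \<phi> r x \<in> lin_iso R (page C1 r x) (page C2 r x))"

text \<open>The maps \<open>E\<^sub>r(1) \<rightarrow> E\<^sub>r(2)\<close> and \<open>E\<^sub>\<infinity>(1) \<rightarrow> E\<^sub>\<infinity>(2)\<close> induced by \<open>(f, g)\<close> with target couple \<open>C2\<close>.\<close>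

definition page_map ::
  "('r, 'd2, 'e2) couple \<Rightarrow> (pos \<Rightarrow> 'e1 \<Rightarrow> 'e2) \<Rightarrow> nat \<Rightarrow> pos \<Rightarrow> 'e1 set \<Rightarrow> 'e2 set"
  where "page_map C2 g r x = class_map (E_mod C2 x) (B_sub C2 (r - 1) x) (g x)"

definition E_infinity_map ::
  "('r, 'd2, 'e2) couple \<Rightarrow> (pos \<Rightarrow> 'e1 \<Rightarrow> 'e2) \<Rightarrow> pos \<Rightarrow> 'e1 set \<Rightarrow> 'e2 set"
  where "E_infinity_map C2 g x = class_map (E_mod C2 x) (\<Union>r. B_sub C2 r x) (g x)"


section \<open>The limit abutment\<close>

definition diagonal :: "int \<Rightarrow> pos set"
  where "diagonal n = {x. fst x + snd x = n}"

text \<open>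
  The limit of the \<open>D\<^sub>x\<close> of total degree \<open>n\<close> along the maps \<open>i\<close>, as the module of compatible families.
  This presupposes that \<open>a\<close> has total degree \<open>0\<close>; for \<open>a = (-1, 1)\<close> the \<open>D\<^sub>x\<close> of total degree \<open>n\<close> form a
  single sequence.  The cone maps are the evaluations \<open>u \<mapsto> u x\<close>.
\<close>

definition limit_abut :: "('r, 'd, 'e) couple \<Rightarrow> int \<Rightarrow> ('r, pos \<Rightarrow> 'd) module"
  where "limit_abut C n =
    \<lparr>carrier = {u \<in> (\<Pi>\<^sub>E x\<in>diagonal n. carrier (D_mod C x)).
                  \<forall>x\<in>diagonal n. i_map C x (u x) = u (x + deg_a C)},
     mult = undefined, one = undefined,
     zero = (\<lambda>x\<in>diagonal n. \<zero>\<^bsub>D_mod C x\<^esub>),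
     add = (\<lambda>u v. \<lambda>x\<in>diagonal n. u x \<oplus>\<^bsub>D_mod C x\<^esub> v x),
     smult = (\<lambda>r u. \<lambda>x\<in>diagonal n. r \<odot>\<^bsub>D_mod C x\<^esub> u x)\<rparr>"

definition limit_map :: "(pos \<Rightarrow> 'd1 \<Rightarrow> 'd2) \<Rightarrow> int \<Rightarrow> (pos \<Rightarrow> 'd1) \<Rightarrow> pos \<Rightarrow> 'd2"
  where "limit_map f n u = (\<lambda>x\<in>diagonal n. f x (u x))"

text \<open>
  The canonical filtration of \<open>L\<^sup>n\<close> is formed by the kernels of the cone maps.  Its terms are labelled
  \<open>F\<^sup>p\<^sup>,\<^sup>q\<close> with \<open>p + q = n\<close> up to a translation along the diagonal: \<open>F\<^sup>p\<^sup>,\<^sup>q\<close> is the kernel of the cone map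
  to \<open>D\<close> in position \<open>(p + t, q - t)\<close>.  The translation is needed because an exact couple of bidegree
  \<open>c = (t, -t)\<close> relates \<open>E\<close> in position \<open>(p, q)\<close> to \<open>D\<close> in position \<open>(p + t, q - t)\<close>.
\<close>

definition limit_fil :: "('r, 'd, 'e) couple \<Rightarrow> int \<Rightarrow> pos \<Rightarrow> (pos \<Rightarrow> 'd) set"
  where "limit_fil C t = (\<lambda>(p, q).
    a_kernel (limit_abut C (p + q)) (D_mod C (p + t, q - t)) (\<lambda>u. u (p + t, q - t)))"


section \<open>Hypotheses on exact couples\<close>

definition first_quadrant :: "('r, 'd, 'e) couple \<Rightarrow> bool"
  where "first_quadrant C \<longleftrightarrow>
    (\<forall>r\<ge>2. \<forall>p q. p < 0 \<or> q < 0 \<longrightarrow> zero_module (page C r (p, q)))"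

definition cohomological :: "('r, 'd, 'e) couple \<Rightarrow> bool"
  where "cohomological C \<longleftrightarrow> (\<forall>r\<ge>2. diff_deg C r = (int r, - int r + 1))"

text \<open>
  \<open>\<pi> (p, q)\<close> is the projection in \<open>0 \<rightarrow> F\<^sup>p\<^sup>,\<^sup>q \<rightarrow> F\<^sup>p\<^sup>-\<^sup>1\<^sup>,\<^sup>q\<^sup>+\<^sup>1 \<rightarrow> E\<^sub>\<infinity>\<^sup>p\<^sup>,\<^sup>q \<rightarrow> 0\<close>, whose first map is the
  inclusion.  The kernel condition contains the inclusion \<open>F\<^sup>p\<^sup>,\<^sup>q \<subseteq> F\<^sup>p\<^sup>-\<^sup>1\<^sup>,\<^sup>q\<^sup>+\<^sup>1\<close>.
\<close>

definition matches_limit_abut ::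
  "('r, 'm) ring_scheme \<Rightarrow> ('r, 'd, 'e) couple \<Rightarrow> int \<Rightarrow> (pos \<Rightarrow> (pos \<Rightarrow> 'd) \<Rightarrow> 'e set) \<Rightarrow> bool"
  where "matches_limit_abut R C t \<pi> \<longleftrightarrow>
    (\<forall>n<0. zero_module (limit_abut C n)) \<and>
    (\<forall>n\<ge>0.
       limit_fil C t (n, 0) = {\<zero>\<^bsub>limit_abut C n\<^esub>} \<and>
       limit_fil C t (-1, n + 1) = carrier (limit_abut C n) \<and>
       (\<forall>p q. 0 \<le> p \<and> 0 \<le> q \<and> p + q = n \<longrightarrow>
          (let F' = (limit_abut C n)\<lparr>carrier := limit_fil C t (p - 1, q + 1)\<rparr> in
             \<pi> (p, q) \<in> lin_hom R F' (E_infinity C (p, q)) \<and>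
             \<pi> (p, q) ` carrier F' = carrier (E_infinity C (p, q)) \<and>
             a_kernel F' (E_infinity C (p, q)) (\<pi> (p, q)) = limit_fil C t (p, q))))"

definition matching_compatible ::
  "('r, 'd1, 'e1) couple \<Rightarrow> ('r, 'd2, 'e2) couple \<Rightarrow>
   (pos \<Rightarrow> 'd1 \<Rightarrow> 'd2) \<Rightarrow> (pos \<Rightarrow> 'e1 \<Rightarrow> 'e2) \<Rightarrow> int \<Rightarrow>
   (pos \<Rightarrow> (pos \<Rightarrow> 'd1) \<Rightarrow> 'e1 set) \<Rightarrow> (pos \<Rightarrow> (pos \<Rightarrow> 'd2) \<Rightarrow> 'e2 set) \<Rightarrow> bool"
  where "matching_compatible C1 C2 f g t \<pi>1 \<pi>2 \<longleftrightarrow>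
    (\<forall>p q. 0 \<le> p \<and> 0 \<le> q \<longrightarrow>
       (\<forall>u\<in>limit_fil C1 t (p - 1, q + 1).
          \<pi>2 (p, q) (limit_map f (p + q) u) = E_infinity_map C2 g (p, q) (\<pi>1 (p, q) u)))"

end

theory Submission
  imports Defs
begin

text \<open>
  The theorem is a cohomological form of Zeeman's comparison theorem.  Hypothesis (iii) reduces it to the
  bottom row of \<open>E\<^sub>2\<close>: once \<open>E\<^sub>2\<^sup>p\<^sup>,\<^sup>0(1) \<rightarrow> E\<^sub>2\<^sup>p\<^sup>,\<^sup>0(2)\<close> is an isomorphism for all \<open>p \<ge> 0\<close>, the second pages agree
  everywhere, and then so do all their iterated homologies.  The bottom row is treated by induction on
  \<open>p\<close>, and the content is the step \<open>bottom_row_step\<close>: agreement of \<open>E\<^sub>2\<close> in the columns \<open>\<le> n\<close> forces agreement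
  at \<open>(n + 1, 0)\<close>.

  Agreement in the columns \<open>\<le> n\<close> makes \<open>E\<^sub>r\<close> injective in all these columns for every \<open>r\<close>, and surjective in the
  columns \<open>\<le> n - r + 1\<close> (\<open>columns_all_pages\<close>).  In particular \<open>E\<^sub>\<infinity>\<close> is injective there.  As the abutments
  are isomorphic, going down the filtration one quotient at a time turns this injectivity into
  surjectivity on every filtration step (\<open>fil_lift\<close>), hence on \<open>E\<^sub>\<infinity>\<close> in the columns \<open>\<le> n + 1\<close>
  (\<open>infinity_surj\<close>).  At \<open>(n + 1, 0)\<close>, where \<open>E\<^sub>\<infinity>\<close> embeds into the abutment, the map is also
  injective (\<open>infinity_inj_bottom\<close>).

  It remains to descend from \<open>E\<^sub>\<infinity>\<close> to \<open>E\<^sub>2\<close> at \<open>(n + 1, 0)\<close>.  There \<open>E\<^sub>r\<^sub>+\<^sub>1\<close> is the cokernel of \<open>d\<^sub>r\<close>, whose source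
  \<open>(n + 1 - r, r - 1)\<close> has total degree \<open>n\<close> and lies in the range where the map on \<open>E\<^sub>r\<close> is bijective.  If the map
  also lifts cycles at the source, the images of \<open>d\<^sub>r\<close> correspond and the five lemma gives \<open>E\<^sub>r\<close> from
  \<open>E\<^sub>r\<^sub>+\<^sub>1\<close> (\<open>surj_at_descend\<close>, \<open>inj_at_descend\<close>).  The lifting of cycles is surjectivity on \<open>E\<^sub>r\<^sub>+\<^sub>1\<close> at the source,
  again obtained by descent from \<open>E\<^sub>\<infinity>\<close>.

  All of this is done with representatives in \<open>E\<close> itself.  The differential becomes an additive relation
  (\<open>drel\<close>), and bijectivity on a page becomes a pair of conditions on \<open>Z\<^sub>r\<close> and \<open>B\<^sub>r\<close>, so that five lemma
  arguments are ordinary element chases without iterated quotients.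
\<close>

section \<open>Submodules, linear maps and classes\<close>

context left_module
begin

lemma submoduleI_diff:
  assumes "H \<subseteq> carrier M" "\<zero>\<^bsub>M\<^esub> \<in> H" "\<And>x y. x \<in> H \<Longrightarrow> y \<in> H \<Longrightarrow> x \<ominus>\<^bsub>M\<^esub> y \<in> H"
    and "\<And>r x. r \<in> carrier R \<Longrightarrow> x \<in> H \<Longrightarrow> r \<odot>\<^bsub>M\<^esub> x \<in> H"
  shows "submodule H R M"
proof -
  have neg: "\<ominus>\<^bsub>M\<^esub> x \<in> H" if "x \<in> H" for x
    using assms(1) assms(3)[OF assms(2) that] that by (auto simp: M.minus_eq)
  have add: "x \<oplus>\<^bsub>M\<^esub> y \<in> H" if "x \<in> H" "y \<in> H" for x y
    using assms(3)[OF that(1) neg[OF that(2)]] assms(1) that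
    by (auto simp: M.minus_eq subset_iff)
  show ?thesis
    using assms neg add
    by (auto intro!: submodule.intro subgroup.intro submodule_axioms.intro
        simp: a_inv_def[symmetric])
qed

lemma submodule_facts:
  assumes "submodule H R M"
  shows "H \<subseteq> carrier M" "\<And>x. x \<in> H \<Longrightarrow> x \<in> carrier M" "\<zero>\<^bsub>M\<^esub> \<in> H"
    and "\<And>x y. x \<in> H \<Longrightarrow> y \<in> H \<Longrightarrow> x \<oplus>\<^bsub>M\<^esub> y \<in> H"
    and "\<And>x y. x \<in> H \<Longrightarrow> y \<in> H \<Longrightarrow> x \<ominus>\<^bsub>M\<^esub> y \<in> H"
    and "\<And>r x. r \<in> carrier R \<Longrightarrow> x \<in> H \<Longrightarrow> r \<odot>\<^bsub>M\<^esub> x \<in> H"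
    and "abelian_subgroup H M"
proof -
  have sub: "subgroup H (add_monoid M)"
    using assms by (rule submodule.axioms(1))
  show "abelian_subgroup H M"
    by (intro abelian_subgroupI3 additive_subgroup.intro sub M.abelian_group_axioms)
  interpret S: additive_subgroup H M
    by (rule additive_subgroup.intro[OF sub])
  show "H \<subseteq> carrier M" "\<And>x. x \<in> H \<Longrightarrow> x \<in> carrier M" "\<zero>\<^bsub>M\<^esub> \<in> H"
    and add: "\<And>x y. x \<in> H \<Longrightarrow> y \<in> H \<Longrightarrow> x \<oplus>\<^bsub>M\<^esub> y \<in> H"
    using S.a_subset by auto
  show "\<And>x y. x \<in> H \<Longrightarrow> y \<in> H \<Longrightarrow> x \<ominus>\<^bsub>M\<^esub> y \<in> H"
    using subgroup.m_inv_closed[OF sub] add by (simp add: M.minus_eq a_inv_def)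
  show "\<And>r x. r \<in> carrier R \<Longrightarrow> x \<in> H \<Longrightarrow> r \<odot>\<^bsub>M\<^esub> x \<in> H"
    using submodule.smult_closed[OF assms] .
qed

lemma diff_add_cancel:
  "x \<in> carrier M \<Longrightarrow> y \<in> carrier M \<Longrightarrow> (x \<ominus>\<^bsub>M\<^esub> y) \<oplus>\<^bsub>M\<^esub> y = x"
  by (simp add: M.minus_eq M.a_assoc M.l_neg)

lemma diff_self: "x \<in> carrier M \<Longrightarrow> x \<ominus>\<^bsub>M\<^esub> x = \<zero>\<^bsub>M\<^esub>"
  and diff_zero: "x \<in> carrier M \<Longrightarrow> x \<ominus>\<^bsub>M\<^esub> \<zero>\<^bsub>M\<^esub> = x"
  by (simp_all add: M.minus_eq M.r_neg)

lemma diff_diff_self: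
  "x \<in> carrier M \<Longrightarrow> y \<in> carrier M \<Longrightarrow> x \<ominus>\<^bsub>M\<^esub> (x \<ominus>\<^bsub>M\<^esub> y) = y"
  by (simp add: M.minus_eq M.minus_add M.a_assoc[symmetric] M.r_neg)

lemma diff_diff_add:
  "x \<in> carrier M \<Longrightarrow> y \<in> carrier M \<Longrightarrow> z \<in> carrier M \<Longrightarrow>
    (x \<ominus>\<^bsub>M\<^esub> y) \<ominus>\<^bsub>M\<^esub> z = x \<ominus>\<^bsub>M\<^esub> (y \<oplus>\<^bsub>M\<^esub> z)"
  by (simp add: M.minus_eq M.minus_add M.a_assoc)

lemma diff_eq_zero_iff:
  "x \<in> carrier M \<Longrightarrow> y \<in> carrier M \<Longrightarrow> x \<ominus>\<^bsub>M\<^esub> y = \<zero>\<^bsub>M\<^esub> \<longleftrightarrow> x = y"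
  using diff_add_cancel[of x y] by (auto simp: M.minus_eq M.r_neg)

lemma smult_zero: "r \<in> carrier R \<Longrightarrow> r \<odot>\<^bsub>M\<^esub> \<zero>\<^bsub>M\<^esub> = \<zero>\<^bsub>M\<^esub>"
  using smult_r_distr[of r "\<zero>\<^bsub>M\<^esub>" "\<zero>\<^bsub>M\<^esub>"] smult_closed[of r "\<zero>\<^bsub>M\<^esub>"]
  by (simp add: M.add.r_cancel_one')

lemma coset_eq_iff:
  assumes "submodule B R M" "x \<in> carrier M" "y \<in> carrier M"
  shows "B +>\<^bsub>M\<^esub> x = B +>\<^bsub>M\<^esub> y \<longleftrightarrow> x \<ominus>\<^bsub>M\<^esub> y \<in> B"
proof -
  interpret B: abelian_subgroup B M
    using submodule_facts(7)[OF assms(1)] .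
  show ?thesis
    using B.a_rcos_module[OF assms(3,2)] B.a_rcos_self[OF assms(2)]
      B.a_repr_independence'[OF _ assms(3), of x]
    by (auto simp: M.minus_eq)
qed

lemma coset_eq_self_iff:
  assumes "submodule B R M" "x \<in> carrier M"
  shows "B +>\<^bsub>M\<^esub> x = B \<longleftrightarrow> x \<in> B"
proof -
  interpret B: abelian_subgroup B M
    using submodule_facts(7)[OF assms(1)] .
  show ?thesis
    using B.a_rcos_self[OF assms(2)] B.a_rcos_const by auto
qed

lemma coset_zero: "submodule B R M \<Longrightarrow> B +>\<^bsub>M\<^esub> \<zero>\<^bsub>M\<^esub> = B"
  using coset_eq_self_iff[of B "\<zero>\<^bsub>M\<^esub>"] submodule_facts(3)[of B] by simp

lemma mem_coset_iff:
  assumes "submodule B R M" "x \<in> carrier M"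
  shows "y \<in> B +>\<^bsub>M\<^esub> x \<longleftrightarrow> y \<in> carrier M \<and> y \<ominus>\<^bsub>M\<^esub> x \<in> B"
proof -
  interpret B: abelian_subgroup B M
    using submodule_facts(7)[OF assms(1)] .
  show ?thesis
    using B.a_rcos_module[OF assms(2), of y] B.a_elemrcos_carrier[OF assms(2), of y]
    by (auto simp: M.minus_eq)
qed

end

lemma lin_hom_closed: "h \<in> lin_hom R M N \<Longrightarrow> x \<in> carrier M \<Longrightarrow> h x \<in> carrier N"
  and lin_hom_add: "h \<in> lin_hom R M N \<Longrightarrow> x \<in> carrier M \<Longrightarrow> y \<in> carrier M \<Longrightarrow>
    h (x \<oplus>\<^bsub>M\<^esub> y) = h x \<oplus>\<^bsub>N\<^esub> h y"
  and lin_hom_smult: "h \<in> lin_hom R M N \<Longrightarrow> r \<in> carrier R \<Longrightarrow> x \<in> carrier M \<Longrightarrow>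
    h (r \<odot>\<^bsub>M\<^esub> x) = r \<odot>\<^bsub>N\<^esub> h x"
  by (auto simp: lin_hom_def)

locale linear_map = M: left_module R M + N: left_module R N
  for R (structure) and M and N +
  fixes h
  assumes hom: "h \<in> lin_hom R M N"
begin

lemmas closed = lin_hom_closed[OF hom]
lemmas add = lin_hom_add[OF hom]
lemmas smult = lin_hom_smult[OF hom]

lemma zero: "h \<zero>\<^bsub>M\<^esub> = \<zero>\<^bsub>N\<^esub>"
  using add[of "\<zero>\<^bsub>M\<^esub>" "\<zero>\<^bsub>M\<^esub>"] closed[of "\<zero>\<^bsub>M\<^esub>"]
  by (simp add: N.M.add.r_cancel_one')

lemma diff: "x \<in> carrier M \<Longrightarrow> y \<in> carrier M \<Longrightarrow> h (x \<ominus>\<^bsub>M\<^esub> y) = h x \<ominus>\<^bsub>N\<^esub> h y"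
  using add[of "x \<ominus>\<^bsub>M\<^esub> y" y] closed[of "x \<ominus>\<^bsub>M\<^esub> y"] closed[of y]
  by (simp add: M.diff_add_cancel N.M.minus_eq N.M.a_assoc N.M.r_neg)

lemma submodule_image:
  assumes "submodule H R M"
  shows "submodule (h ` H) R N"
proof (rule N.submoduleI_diff)
  note H = M.submodule_facts[OF assms]
  show "h ` H \<subseteq> carrier N" "\<zero>\<^bsub>N\<^esub> \<in> h ` H"
    using H zero[symmetric] closed by auto
  show "x \<ominus>\<^bsub>N\<^esub> y \<in> h ` H" if "x \<in> h ` H" "y \<in> h ` H" for x y
    using that H(2,5) by (auto simp: diff[symmetric])
  show "r \<odot>\<^bsub>N\<^esub> x \<in> h ` H" if "r \<in> carrier R" "x \<in> h ` H" for r x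
    using that H(2,6) by (auto simp: smult[symmetric])
qed

lemma submodule_vimage:
  assumes "submodule H R N"
  shows "submodule {x \<in> carrier M. h x \<in> H} R M"
  using N.submodule_facts[OF assms]
  by (intro M.submoduleI_diff)
    (auto simp: zero diff smult M.smult_closed)

lemma class_map_coset:
  assumes B: "submodule B R M" and B': "submodule B' R N" and "h ` B \<subseteq> B'" and z: "z \<in> carrier M"
  shows "class_map N B' h (B +>\<^bsub>M\<^esub> z) = B' +>\<^bsub>N\<^esub> h z"
proof -
  have "B' +>\<^bsub>N\<^esub> h e = B' +>\<^bsub>N\<^esub> h z" if "e \<in> B +>\<^bsub>M\<^esub> z" for e
    using that assms(3) z
    by (auto simp: M.mem_coset_iff[OF B z] N.coset_eq_iff[OF B'] closed diff[symmetric])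
  moreover have "z \<in> B +>\<^bsub>M\<^esub> z"
    using z M.submodule_facts(3)[OF B] by (simp add: M.mem_coset_iff[OF B z] M.M.minus_eq M.M.r_neg)
  ultimately have "(\<lambda>e. B' +>\<^bsub>N\<^esub> h e) ` (B +>\<^bsub>M\<^esub> z) = {B' +>\<^bsub>N\<^esub> h z}"
    by blast
  then show ?thesis
    by (simp add: class_map_def)
qed

end

context left_module
begin

lemma subquotient_carrier: "carrier (subquotient M Z B) = {B +>\<^bsub>M\<^esub> z |z. z \<in> Z}"
  and subquotient_zero: "\<zero>\<^bsub>subquotient M Z B\<^esub> = B"
  by (simp_all add: subquotient_def)

lemma subquotient_add:
  assumes "submodule B R M" "x \<in> carrier M" "y \<in> carrier M"
  shows "(B +>\<^bsub>M\<^esub> x) \<oplus>\<^bsub>subquotient M Z B\<^esub> (B +>\<^bsub>M\<^esub> y) = B +>\<^bsub>M\<^esub> (x \<oplus>\<^bsub>M\<^esub> y)"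
  using abelian_subgroup.a_rcos_sum[OF submodule_facts(7)[OF assms(1)] assms(2,3)]
  by (simp add: subquotient_def)

text \<open>
  Scalar multiplication by \<open>r\<close> on classes is well defined although it need not be linear over a
  noncommutative ring, so the additive argument is given directly.
\<close>

lemma subquotient_smult:
  assumes B: "submodule B R M" and r: "r \<in> carrier R" and x: "x \<in> carrier M"
  shows "r \<odot>\<^bsub>subquotient M Z B\<^esub> (B +>\<^bsub>M\<^esub> x) = B +>\<^bsub>M\<^esub> (r \<odot>\<^bsub>M\<^esub> x)"
proof -
  have "B +>\<^bsub>M\<^esub> (r \<odot>\<^bsub>M\<^esub> e) = B +>\<^bsub>M\<^esub> (r \<odot>\<^bsub>M\<^esub> x)" if "e \<in> B +>\<^bsub>M\<^esub> x" for e
  proof -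
    have e: "e \<in> carrier M" "e \<ominus>\<^bsub>M\<^esub> x \<in> B"
      using that by (auto simp: mem_coset_iff[OF B x])
    have "r \<odot>\<^bsub>M\<^esub> e = r \<odot>\<^bsub>M\<^esub> (e \<ominus>\<^bsub>M\<^esub> x) \<oplus>\<^bsub>M\<^esub> r \<odot>\<^bsub>M\<^esub> x"
      using e x r by (simp add: smult_r_distr[symmetric] diff_add_cancel)
    then have "r \<odot>\<^bsub>M\<^esub> e \<ominus>\<^bsub>M\<^esub> r \<odot>\<^bsub>M\<^esub> x = r \<odot>\<^bsub>M\<^esub> (e \<ominus>\<^bsub>M\<^esub> x)"
      using e x r by (simp add: M.minus_eq M.a_assoc M.r_neg smult_closed)
    then show ?thesis
      using e x r submodule_facts(6)[OF B] by (simp add: coset_eq_iff[OF B] smult_closed)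
  qed
  moreover have "x \<in> B +>\<^bsub>M\<^esub> x"
    using x submodule_facts(3)[OF B] by (simp add: mem_coset_iff[OF B x] M.minus_eq M.r_neg)
  ultimately have "(\<lambda>e. B +>\<^bsub>M\<^esub> (r \<odot>\<^bsub>M\<^esub> e)) ` (B +>\<^bsub>M\<^esub> x) = {B +>\<^bsub>M\<^esub> (r \<odot>\<^bsub>M\<^esub> x)}"
    by blast
  then show ?thesis
    by (simp add: subquotient_def)
qed

lemma zero_subquotientD:
  assumes "submodule B R M" "submodule Z R M" "zero_module (subquotient M Z B)"
  shows "Z \<subseteq> B"
proof
  fix z assume z: "z \<in> Z"
  then have "B +>\<^bsub>M\<^esub> z = B"
    using assms(3) by (auto simp: zero_module_def subquotient_def)
  then show "z \<in> B"
    using coset_eq_self_iff[OF assms(1)] submodule_facts(2)[OF assms(2) z] by blast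
qed

end

lemma (in linear_map) class_map_lin_hom:
  assumes B: "submodule B R M" and B': "submodule B' R N" and Z: "submodule Z R M"
    and "h ` B \<subseteq> B'" and "h ` Z \<subseteq> Z'"
  shows "class_map N B' h \<in> lin_hom R (subquotient M Z B) (subquotient N Z' B')"
  unfolding lin_hom_def
proof (intro CollectI conjI ballI)
  note c = class_map_coset[OF B B' assms(4)]
  note Zc = M.submodule_facts[OF Z]
  show "class_map N B' h \<in> carrier (subquotient M Z B) \<rightarrow> carrier (subquotient N Z' B')"
  proof
    fix X assume "X \<in> carrier (subquotient M Z B)"
    then obtain x where "x \<in> Z" "X = B +>\<^bsub>M\<^esub> x"
      by (auto simp: M.subquotient_carrier)
    then show "class_map N B' h X \<in> carrier (subquotient N Z' B')"
      using assms(5) Zc(2) by (auto simp: N.subquotient_carrier c)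
  qed
  fix X assume "X \<in> carrier (subquotient M Z B)"
  then obtain x where x: "X = B +>\<^bsub>M\<^esub> x" "x \<in> carrier M"
    using Zc by (auto simp: M.subquotient_carrier)
  show "class_map N B' h (X \<oplus>\<^bsub>subquotient M Z B\<^esub> Y)
      = class_map N B' h X \<oplus>\<^bsub>subquotient N Z' B'\<^esub> class_map N B' h Y"
    if "Y \<in> carrier (subquotient M Z B)" for Y
  proof -
    obtain y where "Y = B +>\<^bsub>M\<^esub> y" "y \<in> carrier M"
      using Zc \<open>Y \<in> _\<close> by (auto simp: M.subquotient_carrier)
    then show ?thesis
      using x by (simp add: M.subquotient_add[OF B] N.subquotient_add[OF B'] c closed add)
  qed
  show "class_map N B' h (r \<odot>\<^bsub>subquotient M Z B\<^esub> X)
      = r \<odot>\<^bsub>subquotient N Z' B'\<^esub> class_map N B' h X" if "r \<in> carrier R" for r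
    using x that
    by (simp add: M.subquotient_smult[OF B] N.subquotient_smult[OF B'] c closed smult M.smult_closed)
qed

lemma (in linear_map) class_map_inj_iff:
  assumes B: "submodule B R M" and B': "submodule B' R N" and Z: "submodule Z R M"
    and "h ` B \<subseteq> B'"
  shows "inj_on (class_map N B' h) (carrier (subquotient M Z B)) \<longleftrightarrow> (\<forall>e\<in>Z. h e \<in> B' \<longrightarrow> e \<in> B)"
    (is "?inj \<longleftrightarrow> ?ker")
proof
  note c = class_map_coset[OF B B' assms(4)]
  note Zc = M.submodule_facts[OF Z]
  show ?ker if ?inj
  proof (intro ballI impI)
    fix e assume e: "e \<in> Z" "h e \<in> B'"
    have "class_map N B' h (B +>\<^bsub>M\<^esub> e) = class_map N B' h (B +>\<^bsub>M\<^esub> \<zero>\<^bsub>M\<^esub>)"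
      using e Zc(2) N.submodule_facts(3)[OF B']
      by (simp add: c zero N.coset_eq_self_iff[OF B', THEN iffD2] closed)
    then have "B +>\<^bsub>M\<^esub> e = B +>\<^bsub>M\<^esub> \<zero>\<^bsub>M\<^esub>"
      using that e(1) Zc(3) by (auto simp: inj_on_def M.subquotient_carrier)
    also have "\<dots> = B"
      using M.submodule_facts(3)[OF B] by (simp add: M.coset_eq_self_iff[OF B])
    finally show "e \<in> B"
      using e(1) Zc(2) by (simp add: M.coset_eq_self_iff[OF B])
  qed
  show ?inj if ?ker
  proof (rule inj_onI)
    fix X Y assume "X \<in> carrier (subquotient M Z B)" "Y \<in> carrier (subquotient M Z B)"
      and eq: "class_map N B' h X = class_map N B' h Y"
    then obtain x y where x: "X = B +>\<^bsub>M\<^esub> x" "x \<in> Z" and y: "Y = B +>\<^bsub>M\<^esub> y" "y \<in> Z"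
      by (auto simp: M.subquotient_carrier)
    have "h (x \<ominus>\<^bsub>M\<^esub> y) \<in> B'"
      using eq x y Zc(2) by (simp add: c diff N.coset_eq_iff[OF B'] closed)
    then have "x \<ominus>\<^bsub>M\<^esub> y \<in> B"
      using that x y Zc(5) by blast
    then show "X = Y"
      using x y Zc(2) by (simp add: M.coset_eq_iff[OF B])
  qed
qed

lemma (in linear_map) class_map_surj_iff:
  assumes B: "submodule B R M" and B': "submodule B' R N" and Z: "submodule Z R M"
    and Z': "submodule Z' R N" and "h ` B \<subseteq> B'" and hZ: "h ` Z \<subseteq> Z'"
  shows "class_map N B' h ` carrier (subquotient M Z B) = carrier (subquotient N Z' B') \<longleftrightarrow>
    (\<forall>e'\<in>Z'. \<exists>e\<in>Z. e' \<ominus>\<^bsub>N\<^esub> h e \<in> B')" (is "?L = ?T \<longleftrightarrow> ?R")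
proof -
  note Zc = M.submodule_facts[OF Z] and Zc' = N.submodule_facts[OF Z']
  have L: "?L = (\<lambda>e. B' +>\<^bsub>N\<^esub> h e) ` Z"
  proof -
    have "?L = (\<lambda>e. class_map N B' h (B +>\<^bsub>M\<^esub> e)) ` Z"
      unfolding M.subquotient_carrier by blast
    also have "\<dots> = (\<lambda>e. B' +>\<^bsub>N\<^esub> h e) ` Z"
      using class_map_coset[OF B B' assms(5)] Zc(2) by (intro image_cong) auto
    finally show ?thesis .
  qed
  have T: "?T = (\<lambda>e'. B' +>\<^bsub>N\<^esub> e') ` Z'"
    by (auto simp: N.subquotient_carrier)
  have "?L \<subseteq> ?T"
    unfolding L T using hZ by blast
  then have "?L = ?T \<longleftrightarrow> ?T \<subseteq> ?L"
    unfolding set_eq_subset by simp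
  also have "\<dots> \<longleftrightarrow> (\<forall>e'\<in>Z'. \<exists>e\<in>Z. B' +>\<^bsub>N\<^esub> e' = B' +>\<^bsub>N\<^esub> h e)"
    unfolding L T image_subset_iff by (simp only: image_iff)
  also have "\<dots> \<longleftrightarrow> ?R"
    using Zc(2) Zc'(2) closed by (intro ball_cong bex_cong refl N.coset_eq_iff[OF B']) auto
  finally show ?thesis .
qed


section \<open>The differentials of an exact couple on representatives\<close>

lemma zscale_0 [simp]: "zscale 0 a = 0"
  and zscale_Suc: "zscale (int (Suc m)) a = zscale (int m) a + a"
  by (simp_all add: zscale_def prod_eq_iff algebra_simps)

locale exact_couple_loc =
  fixes R :: "('r, 'm) ring_scheme" and C :: "('r, 'd, 'e) couple"
  assumes exact: "exact_couple R C"
begin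

abbreviation (input) "D \<equiv> D_mod C"
abbreviation (input) "E \<equiv> E_mod C"
abbreviation (input) "Z \<equiv> Z_sub C"
abbreviation (input) "B \<equiv> B_sub C"

lemma D_module: "left_module R (D x)"
  and E_module: "left_module R (E x)"
  using exact by (simp_all add: exact_couple_def del: split_paired_All)

sublocale D: left_module R "D x" for x
  by (rule D_module)
sublocale E: left_module R "E x" for x
  by (rule E_module)

lemma i_hom: "y = x + deg_a C \<Longrightarrow> i_map C x \<in> lin_hom R (D x) (D y)"
  and j_hom: "y = x + deg_b C \<Longrightarrow> j_map C x \<in> lin_hom R (D x) (E y)"
  and k_hom: "y = x + deg_c C \<Longrightarrow> k_map C x \<in> lin_hom R (E x) (D y)"
  using exact by (simp_all add: exact_couple_def del: split_paired_All)

lemma ker_j: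
  assumes "x = w + deg_a C" and "u \<in> carrier (D x)" and "y = x + deg_b C"
  shows "j_map C x u = \<zero>\<^bsub>E y\<^esub> \<longleftrightarrow> u \<in> i_map C w ` carrier (D w)"
proof -
  have "i_map C (x - deg_a C) ` carrier (D (x - deg_a C)) = a_kernel (D x) (E (x + deg_b C)) (j_map C x)"
    using exact by (simp add: exact_couple_def del: split_paired_All)
  then show ?thesis
    using assms by (auto simp: a_kernel_def')
qed

lemma ker_k:
  assumes "x = w + deg_b C" and "e \<in> carrier (E x)" and "y = x + deg_c C"
  shows "k_map C x e = \<zero>\<^bsub>D y\<^esub> \<longleftrightarrow> e \<in> j_map C w ` carrier (D w)"
proof -
  have "j_map C w ` carrier (D w)
      = a_kernel (E (w + deg_b C)) (D (w + deg_b C + deg_c C)) (k_map C (w + deg_b C))"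
    using exact by (simp add: exact_couple_def del: split_paired_All)
  then show ?thesis
    using assms by (auto simp: a_kernel_def')
qed

lemma ker_i:
  assumes "x = w + deg_c C" and "u \<in> carrier (D x)" and "y = x + deg_a C"
  shows "i_map C x u = \<zero>\<^bsub>D y\<^esub> \<longleftrightarrow> u \<in> k_map C w ` carrier (E w)"
proof -
  have "\<forall>x. k_map C (x + deg_b C) ` carrier (E (x + deg_b C))
         = a_kernel (D (x + deg_b C + deg_c C)) (D (x + deg_a C + deg_b C + deg_c C))
             (i_map C (x + deg_b C + deg_c C))"
    using exact by (simp add: exact_couple_def del: split_paired_All)
  from spec[OF this, of "w - deg_b C"]
  have "k_map C w ` carrier (E w) = a_kernel (D x) (D y) (i_map C x)"
    using assms by (simp add: algebra_simps)
  then show ?thesis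
    using assms by (auto simp: a_kernel_def')
qed

lemma i_pow_hom: "y = x + zscale (int m) (deg_a C) \<Longrightarrow> i_pow C m x \<in> lin_hom R (D x) (D y)"
proof (induction m arbitrary: y)
  case 0
  then show ?case
    by (simp add: lin_hom_def)
next
  case (Suc m)
  let ?z = "x + zscale (int m) (deg_a C)"
  have i: "i_map C ?z \<in> lin_hom R (D ?z) (D y)"
    using Suc.prems by (intro i_hom) (simp add: zscale_Suc add.assoc del: of_nat_Suc)
  show ?case
    using i Suc.IH[OF refl] by (auto simp: lin_hom_def Pi_iff)
qed

lemma i_pow_Suc_right: "i_pow C (Suc m) x u = i_pow C m (x + deg_a C) (i_map C x u)"
proof (induction m)
  case (Suc m)
  have "i_pow C (Suc (Suc m)) x u
      = i_map C (x + zscale (int (Suc m)) (deg_a C)) (i_pow C m (x + deg_a C) (i_map C x u))"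
    using Suc.IH by (simp del: of_nat_Suc)
  also have "x + zscale (int (Suc m)) (deg_a C) = x + deg_a C + zscale (int m) (deg_a C)"
    by (simp add: zscale_Suc algebra_simps del: of_nat_Suc)
  finally show ?case
    by simp
qed simp

lemma i_linear: "y = x + deg_a C \<Longrightarrow> linear_map R (D x) (D y) (i_map C x)"
  and j_linear: "y = x + deg_b C \<Longrightarrow> linear_map R (D x) (E y) (j_map C x)"
  and k_linear: "y = x + deg_c C \<Longrightarrow> linear_map R (E x) (D y) (k_map C x)"
  and i_pow_linear: "y = x + zscale (int m) (deg_a C) \<Longrightarrow> linear_map R (D x) (D y) (i_pow C m x)"
  by (simp_all add: linear_map_def linear_map_axioms_def D_module E_module
      i_hom j_hom k_hom i_pow_hom)

text \<open>The position at which elements \<open>k e\<close>, for \<open>e\<close> at \<open>x\<close>, are divided by \<open>i\<^sup>m\<close>.\<close>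

definition lift_pos :: "nat \<Rightarrow> pos \<Rightarrow> pos"
  where "lift_pos m x = x + deg_c C - zscale (int m) (deg_a C)"

text \<open>
  The differential \<open>d\<^sub>m\<^sub>+\<^sub>1\<close> is induced by the additive relation \<open>j \<circ> (i\<^sup>m)\<^sup>-\<^sup>1 \<circ> k\<close> on \<open>E\<close>.  Arguing with this
  relation on representatives avoids computing in iterated quotients: its domain is \<open>Z\<^sub>m\<close>, its image
  is \<open>B\<^sub>m\<^sub>+\<^sub>1\<close>, and the preimage of \<open>B\<^sub>m\<close> is \<open>Z\<^sub>m\<^sub>+\<^sub>1\<close>.
\<close>

definition drel :: "nat \<Rightarrow> pos \<Rightarrow> 'e \<Rightarrow> 'e \<Rightarrow> bool"
  where "drel m x e b \<longleftrightarrow> e \<in> carrier (E x) \<and>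
    (\<exists>y\<in>carrier (D (lift_pos m x)).
      i_pow C m (lift_pos m x) y = k_map C x e \<and> b = j_map C (lift_pos m x) y)"

lemma lift_pos_b: "x + diff_deg C (Suc m) = lift_pos m x + deg_b C"
  and lift_pos_c: "x + deg_c C = lift_pos m x + zscale (int m) (deg_a C)"
  and lift_pos_Suc: "lift_pos m x = lift_pos (Suc m) x + deg_a C"
  unfolding lift_pos_def diff_deg_def zscale_Suc by (simp_all add: algebra_simps)

lemma lift_linear:
  shows "linear_map R (D (lift_pos m x)) (D (x + deg_c C)) (i_pow C m (lift_pos m x))"
    and "linear_map R (D (lift_pos m x)) (E (x + diff_deg C (Suc m))) (j_map C (lift_pos m x))"
  by (rule i_pow_linear, rule lift_pos_c) (rule j_linear, rule lift_pos_b)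

lemma Z_submodule: "submodule (Z m x) R (E x)"
proof -
  interpret k: linear_map R "E x" "D (x + deg_c C)" "k_map C x"
    by (rule k_linear) simp
  interpret i: linear_map R "D (lift_pos m x)" "D (x + deg_c C)" "i_pow C m (lift_pos m x)"
    by (rule lift_linear)
  have "submodule (carrier (D (lift_pos m x))) R (D (lift_pos m x))"
    by (rule D.submoduleI_diff) (auto simp: D.smult_closed)
  from k.submodule_vimage[OF i.submodule_image[OF this]] show ?thesis
    by (simp add: Z_sub_def lift_pos_def)
qed

lemma B_submodule: "submodule (B m x) R (E x)"
proof -
  let ?x = "x - deg_b C"
  interpret i: linear_map R "D ?x" "D (?x + zscale (int m) (deg_a C))" "i_pow C m ?x"
    by (rule i_pow_linear) simp
  interpret j: linear_map R "D ?x" "E x" "j_map C ?x"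
    by (rule j_linear) simp
  let ?y = "?x + zscale (int m) (deg_a C)"
  have "submodule {\<zero>\<^bsub>D ?y\<^esub>} R (D ?y)"
    by (rule D.submoduleI_diff) (auto simp: D.smult_zero D.M.minus_eq D.M.r_neg)
  from j.submodule_image[OF i.submodule_vimage[OF this]] show ?thesis
    by (simp add: B_sub_def a_kernel_def')
qed

lemmas Z_facts = E.submodule_facts[OF Z_submodule]
lemmas B_facts = E.submodule_facts[OF B_submodule]

lemma Z_iff_drel: "e \<in> Z m x \<longleftrightarrow> (\<exists>b. drel m x e b)"
proof -
  have "e \<in> Z m x \<longleftrightarrow> e \<in> carrier (E x) \<and>
      (\<exists>y\<in>carrier (D (lift_pos m x)). i_pow C m (lift_pos m x) y = k_map C x e)"
    by (auto simp: Z_sub_def lift_pos_def image_iff eq_commute)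
  then show ?thesis
    unfolding drel_def by blast
qed

lemma im_j_in_Z:
  assumes "x = w + deg_b C" "y \<in> carrier (D w)"
  shows "j_map C w y \<in> Z m x"
proof -
  interpret j: linear_map R "D w" "E x" "j_map C w"
    by (rule j_linear) (rule assms(1))
  interpret i: linear_map R "D (lift_pos m x)" "D (x + deg_c C)" "i_pow C m (lift_pos m x)"
    by (rule lift_linear)
  have "k_map C x (j_map C w y) = \<zero>\<^bsub>D (x + deg_c C)\<^esub>"
    using ker_k[OF assms(1) j.closed[OF assms(2)] refl] assms(2) by blast
  then show ?thesis
    using assms(2) i.zero j.closed
    by (auto simp: Z_sub_def lift_pos_def intro!: image_eqI[where x="\<zero>\<^bsub>D _\<^esub>"])
qed

text \<open>Boundaries of any page lie in the image of \<open>j\<close>, so they are killed by \<open>k\<close> and survive as cycles for ever.\<close>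

lemma B_subset_Z: "B m x \<subseteq> Z m' x"
  using im_j_in_Z[of x "x - deg_b C"] by (auto simp: B_sub_def a_kernel_def')

lemma Z_Suc_subset: "Z (Suc m) x \<subseteq> Z m x"
proof
  fix e assume "e \<in> Z (Suc m) x"
  then obtain y where e: "e \<in> carrier (E x)" and y: "y \<in> carrier (D (lift_pos (Suc m) x))"
    and ke: "k_map C x e = i_pow C (Suc m) (lift_pos (Suc m) x) y"
    by (auto simp: Z_sub_def lift_pos_def)
  interpret i: linear_map R "D (lift_pos (Suc m) x)" "D (lift_pos m x)" "i_map C (lift_pos (Suc m) x)"
    by (rule i_linear) (rule lift_pos_Suc)
  show "e \<in> Z m x"
    using e i.closed[OF y] ke unfolding i_pow_Suc_right lift_pos_Suc[symmetric]
    by (auto simp: Z_sub_def lift_pos_def)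
qed

lemma B_Suc_supset: "B m x \<subseteq> B (Suc m) x"
proof -
  let ?x = "x - deg_b C"
  let ?y = "?x + zscale (int m) (deg_a C)"
  interpret i: linear_map R "D ?y" "D (?x + zscale (int (Suc m)) (deg_a C))" "i_map C ?y"
    by (rule i_linear) (simp add: zscale_Suc add.assoc del: of_nat_Suc)
  show ?thesis
    using i.zero by (auto simp: B_sub_def a_kernel_def' simp del: of_nat_Suc)
qed

lemma drel_domain: "drel m x e b \<Longrightarrow> e \<in> Z m x"
  by (auto simp: Z_iff_drel)

lemma drel_in_Z: "drel m x e b \<Longrightarrow> b \<in> Z m' (x + diff_deg C (Suc m))"
  unfolding drel_def using im_j_in_Z[OF lift_pos_b] by blast

lemma drel_diff:
  assumes "drel m x e b" "drel m x e' b'"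
  shows "drel m x (e \<ominus>\<^bsub>E x\<^esub> e') (b \<ominus>\<^bsub>E (x + diff_deg C (Suc m))\<^esub> b')"
proof -
  interpret k: linear_map R "E x" "D (x + deg_c C)" "k_map C x"
    by (rule k_linear) simp
  interpret i: linear_map R "D (lift_pos m x)" "D (x + deg_c C)" "i_pow C m (lift_pos m x)"
    by (rule lift_linear)
  interpret j: linear_map R "D (lift_pos m x)" "E (x + diff_deg C (Suc m))" "j_map C (lift_pos m x)"
    by (rule lift_linear)
  obtain y y' where "y \<in> carrier (D (lift_pos m x))" "y' \<in> carrier (D (lift_pos m x))"
    "i_pow C m (lift_pos m x) y = k_map C x e" "b = j_map C (lift_pos m x) y"
    "i_pow C m (lift_pos m x) y' = k_map C x e'" "b' = j_map C (lift_pos m x) y'"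
    using assms by (auto simp: drel_def)
  then show ?thesis
    using assms unfolding drel_def
    by (intro conjI bexI[of _ "y \<ominus>\<^bsub>D (lift_pos m x)\<^esub> y'"]) (auto simp: k.diff i.diff j.diff)
qed

text \<open>
  If \<open>i\<^sup>m y = k e\<close> and \<open>j y \<in> B\<^sub>m\<close>, then \<open>y\<close> can be changed by an element of \<open>ker i\<^sup>m\<close> so that \<open>j y = 0\<close>,
  that is, so that \<open>y\<close> is divisible by \<open>i\<close>; conversely a lift \<open>i z\<close> is killed by \<open>j\<close>.
\<close>

lemma drel_cycle_iff:
  assumes "drel m x e b"
  shows "e \<in> Z (Suc m) x \<longleftrightarrow> b \<in> B m (x + diff_deg C (Suc m))"
proof -
  let ?w = "lift_pos m x" and ?v = "lift_pos (Suc m) x" and ?t = "x + diff_deg C (Suc m)"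
  interpret i1: linear_map R "D ?v" "D ?w" "i_map C ?v"
    by (rule i_linear) (rule lift_pos_Suc)
  interpret i: linear_map R "D ?w" "D (x + deg_c C)" "i_pow C m ?w"
    by (rule lift_linear)
  interpret j: linear_map R "D ?w" "E ?t" "j_map C ?w"
    by (rule lift_linear)
  obtain y where e: "e \<in> carrier (E x)" and y: "y \<in> carrier (D ?w)"
    and ke: "i_pow C m ?w y = k_map C x e" and b: "b = j_map C ?w y"
    using assms by (auto simp: drel_def)
  have t: "?t - deg_b C = ?w" "?w + zscale (int m) (deg_a C) = x + deg_c C"
    using lift_pos_b[of x m] lift_pos_c[of x m] by simp_all
  have B: "B m ?t = j_map C ?w ` {y \<in> carrier (D ?w). i_pow C m ?w y = \<zero>\<^bsub>D (x + deg_c C)\<^esub>}"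
    unfolding B_sub_def a_kernel_def' t ..
  have jz: "j_map C ?w u = \<zero>\<^bsub>E ?t\<^esub> \<longleftrightarrow> u \<in> i_map C ?v ` carrier (D ?v)" if "u \<in> carrier (D ?w)" for u
    by (rule ker_j[OF lift_pos_Suc that lift_pos_b])
  have Z: "e \<in> Z (Suc m) x \<longleftrightarrow> (\<exists>z\<in>carrier (D ?v). k_map C x e = i_pow C m ?w (i_map C ?v z))"
    using e unfolding Z_sub_def lift_pos_def[symmetric] i_pow_Suc_right lift_pos_Suc[symmetric]
    by auto
  show ?thesis
  proof
    assume "e \<in> Z (Suc m) x"
    then obtain z where z: "z \<in> carrier (D ?v)" "k_map C x e = i_pow C m ?w (i_map C ?v z)"
      using Z by blast
    let ?y = "y \<ominus>\<^bsub>D ?w\<^esub> i_map C ?v z"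
    have "j_map C ?w (i_map C ?v z) = \<zero>\<^bsub>E ?t\<^esub>"
      using jz z(1) i1.closed by blast
    then have "j_map C ?w ?y = b"
      using y z(1) i1.closed b j.closed[OF y]
      by (simp add: j.diff E.diff_zero)
    moreover have "i_pow C m ?w ?y = \<zero>\<^bsub>D (x + deg_c C)\<^esub>"
      using y z i1.closed ke i.closed by (simp add: i.diff D.diff_self)
    ultimately show "b \<in> B m ?t"
      unfolding B using y i1.closed[OF z(1)] by (intro image_eqI[of _ _ ?y]) simp_all
  next
    assume "b \<in> B m ?t"
    then obtain y' where y': "y' \<in> carrier (D ?w)" "i_pow C m ?w y' = \<zero>\<^bsub>D (x + deg_c C)\<^esub>"
      "b = j_map C ?w y'"
      unfolding B by blast
    have "j_map C ?w (y \<ominus>\<^bsub>D ?w\<^esub> y') = \<zero>\<^bsub>E ?t\<^esub>"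
      using y y' b j.closed[OF y] by (simp add: j.diff E.diff_eq_zero_iff)
    then obtain z where z: "z \<in> carrier (D ?v)" "y \<ominus>\<^bsub>D ?w\<^esub> y' = i_map C ?v z"
      using jz[of "y \<ominus>\<^bsub>D ?w\<^esub> y'"] y y'(1) by auto
    have "i_pow C m ?w (y \<ominus>\<^bsub>D ?w\<^esub> y') = k_map C x e"
      using y y' ke i.closed[OF y] by (simp add: i.diff D.diff_zero)
    then show "e \<in> Z (Suc m) x"
      using Z z by metis
  qed
qed

text \<open>Exactness at \<open>D\<close>: if \<open>i (i\<^sup>m y) = 0\<close> then \<open>i\<^sup>m y\<close> lies in the image of \<open>k\<close>.\<close>

lemma boundary_is_drel_value:
  assumes "b \<in> B (Suc m) (x + diff_deg C (Suc m))"
  shows "\<exists>e. drel m x e b"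
proof -
  let ?w = "lift_pos m x" and ?t = "x + diff_deg C (Suc m)"
  interpret i: linear_map R "D ?w" "D (x + deg_c C)" "i_pow C m ?w"
    by (rule lift_linear)
  have t: "?t - deg_b C = ?w" "?w + zscale (int m) (deg_a C) = x + deg_c C"
    "?w + zscale (int (Suc m)) (deg_a C) = x + deg_c C + deg_a C"
    using lift_pos_b[of x m] lift_pos_c[of x m]
    by (simp_all add: zscale_Suc add.assoc[symmetric] del: of_nat_Suc)
  obtain y where y: "y \<in> carrier (D ?w)" "b = j_map C ?w y"
    "i_map C (x + deg_c C) (i_pow C m ?w y) = \<zero>\<^bsub>D (x + deg_c C + deg_a C)\<^esub>"
    using assms unfolding B_sub_def a_kernel_def' t i_pow.simps by blast
  then obtain e where "e \<in> carrier (E x)" "i_pow C m ?w y = k_map C x e"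
    using ker_i[OF refl i.closed[OF y(1)] refl] by blast
  then show ?thesis
    using y(1,2) by (auto simp: drel_def)
qed

lemma drel_value_is_boundary:
  assumes "drel m x e b"
  shows "b \<in> B (Suc m) (x + diff_deg C (Suc m))"
proof -
  let ?w = "lift_pos m x" and ?t = "x + diff_deg C (Suc m)"
  have t: "?t - deg_b C = ?w" "?w + zscale (int m) (deg_a C) = x + deg_c C"
    "?w + zscale (int (Suc m)) (deg_a C) = x + deg_c C + deg_a C"
    using lift_pos_b[of x m] lift_pos_c[of x m]
    by (simp_all add: zscale_Suc add.assoc[symmetric] del: of_nat_Suc)
  obtain y where e: "e \<in> carrier (E x)" and y: "y \<in> carrier (D ?w)" "b = j_map C ?w y"
    "i_pow C m ?w y = k_map C x e"
    using assms by (auto simp: drel_def)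
  have "k_map C x e \<in> carrier (D (x + deg_c C))"
    using lin_hom_closed[OF k_hom[OF refl] e] .
  then have "i_map C (x + deg_c C) (k_map C x e) = \<zero>\<^bsub>D (x + deg_c C + deg_a C)\<^esub>"
    using ker_i[OF refl _ refl] e by blast
  then show ?thesis
    using y unfolding B_sub_def a_kernel_def' t i_pow.simps by auto
qed

lemma drel_well_defined:
  assumes "drel m x e b" "drel m x e' b'" "e \<ominus>\<^bsub>E x\<^esub> e' \<in> B m x"
  shows "b \<ominus>\<^bsub>E (x + diff_deg C (Suc m))\<^esub> b' \<in> B m (x + diff_deg C (Suc m))"
  using drel_cycle_iff[OF drel_diff[OF assms(1,2)]] subsetD[OF B_subset_Z assms(3)] by simp

lemma page_Suc: "page C (Suc m) x = subquotient (E x) (Z m x) (B m x)"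
  by (simp add: page_def)

lemma diff_coset:
  assumes "drel m x e b"
  shows "diff C (Suc m) x (B m x +>\<^bsub>E x\<^esub> e)
    = B m (x + diff_deg C (Suc m)) +>\<^bsub>E (x + diff_deg C (Suc m))\<^esub> b"
proof -
  let ?t = "x + diff_deg C (Suc m)"
  have e: "e \<in> carrier (E x)"
    using assms by (simp add: drel_def)
  have b: "b' \<in> carrier (E ?t)" if "drel m x e' b'" for e' b'
    using drel_in_Z[OF that] Z_facts(2) by blast
  have self: "e \<in> B m x +>\<^bsub>E x\<^esub> e"
    using e B_facts(3) by (simp add: E.mem_coset_iff[OF B_submodule] E.M.minus_eq E.M.r_neg)
  have carr: "e' \<in> carrier (E x)" if "e' \<in> B m x +>\<^bsub>E x\<^esub> e" for e'
    using that e by (simp add: E.mem_coset_iff[OF B_submodule])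
  have same: "B m ?t +>\<^bsub>E ?t\<^esub> b' = B m ?t +>\<^bsub>E ?t\<^esub> b"
    if "e' \<in> B m x +>\<^bsub>E x\<^esub> e" "drel m x e' b'" for e' b'
    using that drel_well_defined[OF that(2) assms] e b[OF that(2)] b[OF assms]
    by (simp add: E.mem_coset_iff[OF B_submodule] E.coset_eq_iff[OF B_submodule])
  have "{B m ?t +>\<^bsub>E ?t\<^esub> j_map C (lift_pos m x) y | y e'. e' \<in> B m x +>\<^bsub>E x\<^esub> e \<and>
      y \<in> carrier (D (lift_pos m x)) \<and> i_pow C m (lift_pos m x) y = k_map C x e'}
    = {B m ?t +>\<^bsub>E ?t\<^esub> b' | b' e'. e' \<in> B m x +>\<^bsub>E x\<^esub> e \<and> drel m x e' b'}"
    using carr unfolding drel_def by blast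
  also have "\<dots> = {B m ?t +>\<^bsub>E ?t\<^esub> b}"
    using same self assms by blast
  finally show ?thesis
    by (simp add: diff_def lift_pos_def)
qed

lemma next_page_coset:
  assumes "e \<in> carrier (E x)"
  shows "next_page C (Suc m) x (B m x +>\<^bsub>E x\<^esub> e) = B (Suc m) x +>\<^bsub>E x\<^esub> e"
proof -
  interpret id: linear_map R "E x" "E x" "\<lambda>e. e"
    by (intro linear_map.intro linear_map_axioms.intro E_module) (simp add: lin_hom_def)
  show ?thesis
    unfolding next_page_def using B_Suc_supset assms
    by (intro id.class_map_coset B_submodule) auto
qed

text \<open>
  A differential with zero target makes every element a cycle, and one with zero source adds no
  boundary.
\<close>

lemma stationary_Z:
  assumes "zero_module (page C (Suc m) (x + diff_deg C (Suc m)))"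
  shows "Z (Suc m) x = Z m x"
proof
  show "Z m x \<subseteq> Z (Suc m) x"
  proof
    fix e assume "e \<in> Z m x"
    then obtain b where b: "drel m x e b"
      using Z_iff_drel by blast
    then show "e \<in> Z (Suc m) x"
      using drel_cycle_iff[OF b] drel_in_Z[OF b]
        E.zero_subquotientD[OF B_submodule Z_submodule assms[unfolded page_Suc]]
      by blast
  qed
qed (rule Z_Suc_subset)

lemma stationary_B:
  assumes "zero_module (page C (Suc m) x)"
  shows "B (Suc m) (x + diff_deg C (Suc m)) = B m (x + diff_deg C (Suc m))"
proof
  show "B (Suc m) (x + diff_deg C (Suc m)) \<subseteq> B m (x + diff_deg C (Suc m))"
  proof
    fix b assume "b \<in> B (Suc m) (x + diff_deg C (Suc m))"
    then obtain e where e: "drel m x e b"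
      using boundary_is_drel_value by blast
    then show "b \<in> B m (x + diff_deg C (Suc m))"
      using drel_cycle_iff[OF e] drel_domain[OF e] B_subset_Z
        E.zero_subquotientD[OF B_submodule Z_submodule assms[unfolded page_Suc]]
      by blast
  qed
qed (rule B_Suc_supset)

end


section \<open>Comparing two exact couples page by page\<close>

locale couple_map = C1: exact_couple_loc R C1 + C2: exact_couple_loc R C2
  for R :: "('r, 'm) ring_scheme"
    and C1 :: "('r, 'd1, 'e1) couple" and C2 :: "('r, 'd2, 'e2) couple" +
  fixes f :: "pos \<Rightarrow> 'd1 \<Rightarrow> 'd2" and g :: "pos \<Rightarrow> 'e1 \<Rightarrow> 'e2"
  assumes morphism: "couple_morphism R C1 C2 f g"
begin

lemma degrees: "deg_a C2 = deg_a C1" "deg_b C2 = deg_b C1" "deg_c C2 = deg_c C1"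
  using morphism by (simp_all add: couple_morphism_def)

lemma diff_deg_eq: "diff_deg C2 r = diff_deg C1 r"
  by (simp add: diff_deg_def degrees)

lemma lift_pos_eq: "C2.lift_pos m x = C1.lift_pos m x"
  by (simp add: C1.lift_pos_def C2.lift_pos_def degrees)

lemma f_linear: "linear_map R (D_mod C1 x) (D_mod C2 x) (f x)"
  and g_linear: "linear_map R (E_mod C1 x) (E_mod C2 x) (g x)"
  using morphism
  by (simp_all add: linear_map_def linear_map_axioms_def C1.D_module C2.D_module
      C1.E_module C2.E_module couple_morphism_def del: split_paired_All)

sublocale f: linear_map R "D_mod C1 x" "D_mod C2 x" "f x" for x
  by (rule f_linear)
sublocale g: linear_map R "E_mod C1 x" "E_mod C2 x" "g x" for x
  by (rule g_linear)

lemma f_i: "u \<in> carrier (D_mod C1 x) \<Longrightarrow> f (x + deg_a C1) (i_map C1 x u) = i_map C2 x (f x u)"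
  and g_j: "u \<in> carrier (D_mod C1 x) \<Longrightarrow> g (x + deg_b C1) (j_map C1 x u) = j_map C2 x (f x u)"
  and f_k: "e \<in> carrier (E_mod C1 x) \<Longrightarrow> f (x + deg_c C1) (k_map C1 x e) = k_map C2 x (g x e)"
  using morphism unfolding couple_morphism_def by blast+

lemma f_i_pow:
  assumes "u \<in> carrier (D_mod C1 x)"
  shows "f (x + zscale (int m) (deg_a C1)) (i_pow C1 m x u) = i_pow C2 m x (f x u)"
proof (induction m)
  case (Suc m)
  have "i_pow C1 m x u \<in> carrier (D_mod C1 (x + zscale (int m) (deg_a C1)))"
    using lin_hom_closed[OF C1.i_pow_hom[OF refl] assms] .
  from f_i[OF this] Suc.IH show ?case
    by (simp add: zscale_Suc degrees add.assoc del: of_nat_Suc)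
qed simp

text \<open>Naturality of the differentials, on representatives.\<close>

lemma drel_map:
  assumes "C1.drel m x e b"
  shows "C2.drel m x (g x e) (g (x + diff_deg C1 (Suc m)) b)"
proof -
  let ?w = "C1.lift_pos m x"
  obtain y where e: "e \<in> carrier (E_mod C1 x)" and y: "y \<in> carrier (D_mod C1 ?w)"
    "i_pow C1 m ?w y = k_map C1 x e" "b = j_map C1 ?w y"
    using assms by (auto simp: C1.drel_def)
  have "i_pow C2 m ?w (f ?w y) = k_map C2 x (g x e)"
    using f_i_pow[OF y(1), of m] f_k[OF e] y(2) by (simp add: C1.lift_pos_c[of x m])
  moreover have "g (x + diff_deg C1 (Suc m)) b = j_map C2 ?w (f ?w y)"
    using g_j[OF y(1)] y(3) by (simp add: C1.lift_pos_b)
  ultimately show ?thesis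
    unfolding C2.drel_def lift_pos_eq using e y(1) f.closed g.closed by blast
qed

lemma g_Z: "e \<in> Z_sub C1 m x \<Longrightarrow> g x e \<in> Z_sub C2 m x"
  unfolding C1.Z_iff_drel C2.Z_iff_drel using drel_map by blast

lemma g_B:
  assumes "e \<in> B_sub C1 m x"
  shows "g x e \<in> B_sub C2 m x"
proof -
  let ?w = "x - deg_b C1"
  obtain y where y: "y \<in> carrier (D_mod C1 ?w)" "e = j_map C1 ?w y"
    "i_pow C1 m ?w y = \<zero>\<^bsub>D_mod C1 (?w + zscale (int m) (deg_a C1))\<^esub>"
    using assms unfolding B_sub_def a_kernel_def' by blast
  have "g x e = j_map C2 ?w (f ?w y)"
    using g_j[OF y(1)] y(2) by simp
  moreover have "i_pow C2 m ?w (f ?w y) = \<zero>\<^bsub>D_mod C2 (?w + zscale (int m) (deg_a C1))\<^esub>"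
    using f_i_pow[OF y(1), of m] y(3) by (simp add: f.zero)
  ultimately show ?thesis
    unfolding B_sub_def a_kernel_def' degrees using f.closed[OF y(1)] by blast
qed

lemma g_B_image: "g x ` B_sub C1 m x \<subseteq> B_sub C2 m x"
  and g_Z_image: "g x ` Z_sub C1 m x \<subseteq> Z_sub C2 m x"
  using g_B g_Z by blast+

text \<open>
  Injectivity and surjectivity of \<open>E\<^sub>m\<^sub>+\<^sub>1(1) \<rightarrow> E\<^sub>m\<^sub>+\<^sub>1(2)\<close> at \<open>x\<close>, expressed by representatives.  Note the
  shift: the index \<open>m\<close> of \<open>Z\<close> and \<open>B\<close> belongs to page \<open>m + 1\<close>.
\<close>

definition inj_at :: "nat \<Rightarrow> pos \<Rightarrow> bool"
  where "inj_at m x \<longleftrightarrow> (\<forall>e\<in>Z_sub C1 m x. g x e \<in> B_sub C2 m x \<longrightarrow> e \<in> B_sub C1 m x)"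

definition surj_at :: "nat \<Rightarrow> pos \<Rightarrow> bool"
  where "surj_at m x \<longleftrightarrow> (\<forall>e'\<in>Z_sub C2 m x. \<exists>e\<in>Z_sub C1 m x. e' \<ominus>\<^bsub>E_mod C2 x\<^esub> g x e \<in> B_sub C2 m x)"

lemma page_map_Suc: "page_map C2 g (Suc m) x = class_map (E_mod C2 x) (B_sub C2 m x) (g x)"
  by (simp add: page_map_def)

lemma page_map_coset:
  "e \<in> carrier (E_mod C1 x) \<Longrightarrow>
    page_map C2 g (Suc m) x (B_sub C1 m x +>\<^bsub>E_mod C1 x\<^esub> e) = B_sub C2 m x +>\<^bsub>E_mod C2 x\<^esub> g x e"
  unfolding page_map_Suc
  by (intro g.class_map_coset C1.B_submodule C2.B_submodule g_B_image)

lemma page_map_hom: "page_map C2 g (Suc m) x \<in> lin_hom R (page C1 (Suc m) x) (page C2 (Suc m) x)"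
  unfolding page_map_Suc C1.page_Suc C2.page_Suc
  by (intro g.class_map_lin_hom C1.B_submodule C2.B_submodule C1.Z_submodule g_B_image g_Z_image)

lemma page_map_inj_iff: "inj_on (page_map C2 g (Suc m) x) (carrier (page C1 (Suc m) x)) \<longleftrightarrow> inj_at m x"
  unfolding page_map_Suc C1.page_Suc inj_at_def
  by (intro g.class_map_inj_iff C1.B_submodule C2.B_submodule C1.Z_submodule g_B_image)

lemma page_map_surj_iff:
  "page_map C2 g (Suc m) x ` carrier (page C1 (Suc m) x) = carrier (page C2 (Suc m) x) \<longleftrightarrow> surj_at m x"
  unfolding page_map_Suc C1.page_Suc C2.page_Suc surj_at_def
  by (intro g.class_map_surj_iff C1.B_submodule C2.B_submodule C1.Z_submodule C2.Z_submodule
      g_B_image g_Z_image)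

lemma page_map_iso_iff:
  "page_map C2 g (Suc m) x \<in> lin_iso R (page C1 (Suc m) x) (page C2 (Suc m) x)
    \<longleftrightarrow> inj_at m x \<and> surj_at m x"
  by (simp add: lin_iso_def page_map_hom bij_betw_def page_map_inj_iff page_map_surj_iff)

lemma page_map_ss_morphism: "ss_morphism R C1 C2 (page_map C2 g)"
  unfolding ss_morphism_def
proof (intro conjI allI impI ballI)
  fix r :: nat and x assume "2 \<le> r"
  then obtain m where r: "r = Suc m"
    by (cases r) auto
  show "diff_deg C1 r = diff_deg C2 r"
    by (simp add: diff_deg_eq)
  show "page_map C2 g r x \<in> lin_hom R (page C1 r x) (page C2 r x)"
    unfolding r by (rule page_map_hom)
  let ?t = "x + diff_deg C1 (Suc m)"
  show "page_map C2 g r (x + diff_deg C1 r) (diff C1 r x X) = diff C2 r x (page_map C2 g r x X)"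
    if X_in: "X \<in> carrier (page C1 r x)" for X
  proof -
    obtain e b where X: "X = B_sub C1 m x +>\<^bsub>E_mod C1 x\<^esub> e" and e: "C1.drel m x e b"
      using X_in C1.Z_iff_drel unfolding r C1.page_Suc C1.E.subquotient_carrier by blast
    have carr: "e \<in> carrier (E_mod C1 x)" "b \<in> carrier (E_mod C1 ?t)"
      using C1.Z_facts(2)[OF C1.drel_domain[OF e]] C1.Z_facts(2)[OF C1.drel_in_Z[OF e]] by auto
    show ?thesis
      unfolding r X C1.diff_coset[OF e] page_map_coset[OF carr(1)] page_map_coset[OF carr(2)]
        C2.diff_coset[OF drel_map[OF e]] diff_deg_eq ..
  qed
  show "page_map C2 g (Suc r) x (next_page C1 r x X) = next_page C2 r x (page_map C2 g r x X)"
    if X_in: "X \<in> a_kernel (page C1 r x) (page C1 r (x + diff_deg C1 r)) (diff C1 r x)" for X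
  proof -
    obtain e where X: "X = B_sub C1 m x +>\<^bsub>E_mod C1 x\<^esub> e" and e: "e \<in> carrier (E_mod C1 x)"
      using X_in C1.Z_facts(2)
      unfolding r C1.page_Suc a_kernel_def' C1.E.subquotient_carrier by blast
    show ?thesis
      unfolding r X C1.next_page_coset[OF e] page_map_coset[OF e] C2.next_page_coset[OF g.closed[OF e]] ..
  qed
qed

context
  fixes m :: nat and x y :: pos
  assumes y: "y = x + diff_deg C1 (Suc m)"
begin

text \<open>
  A boundary is the differential of some \<open>e'\<close>; lifting \<open>e'\<close> along a surjection at the source of the
  differential lifts the boundary.
\<close>

lemma lift_boundary:
  assumes "surj_at m x" and "b' \<in> B_sub C2 (Suc m) y"
  shows "\<exists>b\<in>B_sub C1 (Suc m) y. b' \<ominus>\<^bsub>E_mod C2 y\<^esub> g y b \<in> B_sub C2 m y"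
proof -
  obtain e' where e': "C2.drel m x e' b'"
    using C2.boundary_is_drel_value[of b' m x] assms(2) by (auto simp: y diff_deg_eq)
  obtain e where e: "e \<in> Z_sub C1 m x" "e' \<ominus>\<^bsub>E_mod C2 x\<^esub> g x e \<in> B_sub C2 m x"
    using assms(1) C2.drel_domain[OF e'] unfolding surj_at_def by blast
  obtain b where b: "C1.drel m x e b"
    using e(1) C1.Z_iff_drel by blast
  have "b' \<ominus>\<^bsub>E_mod C2 y\<^esub> g y b \<in> B_sub C2 m y"
    using C2.drel_well_defined[OF e' drel_map[OF b] e(2)] by (simp add: y diff_deg_eq)
  then show ?thesis
    using C1.drel_value_is_boundary[OF b] unfolding y by blast
qed

text \<open>
  Pages \<open>m + 1\<close> and \<open>m + 2\<close> at \<open>y\<close> differ by cycles and boundaries.  Injectivity survives when the new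
  boundaries of the target couple come from boundaries of the source couple, so it asks for
  surjectivity at the source of the incoming differential.
\<close>

lemma inj_at_Suc:
  assumes "inj_at m y" and "surj_at m x"
  shows "inj_at (Suc m) y"
  unfolding inj_at_def
proof (intro ballI impI)
  fix e assume e: "e \<in> Z_sub C1 (Suc m) y" "g y e \<in> B_sub C2 (Suc m) y"
  obtain b where b: "b \<in> B_sub C1 (Suc m) y" "g y e \<ominus>\<^bsub>E_mod C2 y\<^esub> g y b \<in> B_sub C2 m y"
    using lift_boundary[OF assms(2) e(2)] by blast
  have Z: "e \<in> Z_sub C1 m y" "b \<in> Z_sub C1 m y"
    using e(1) C1.Z_Suc_subset b(1) C1.B_subset_Z by blast+
  note carr = Z[THEN C1.Z_facts(2)]
  have "e \<ominus>\<^bsub>E_mod C1 y\<^esub> b \<in> B_sub C1 m y"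
    using assms(1) b(2) C1.Z_facts(5)[OF Z] unfolding inj_at_def by (simp add: g.diff carr)
  then have "(e \<ominus>\<^bsub>E_mod C1 y\<^esub> b) \<oplus>\<^bsub>E_mod C1 y\<^esub> b \<in> B_sub C1 (Suc m) y"
    using C1.B_Suc_supset b(1) C1.B_facts(4) by blast
  then show "e \<in> B_sub C1 (Suc m) y"
    by (simp add: C1.E.diff_add_cancel carr)
qed

text \<open>
  Dually, surjectivity survives when cycles lift to cycles: a preimage of a cycle has a differential
  that maps to \<open>0\<close>, so injectivity at the target of the outgoing differential is what is wanted.
\<close>

lemma surj_at_Suc:
  assumes "surj_at m x" and "inj_at m y"
  shows "surj_at (Suc m) x"
  unfolding surj_at_def
proof
  fix e' assume e': "e' \<in> Z_sub C2 (Suc m) x"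
  then obtain e where e: "e \<in> Z_sub C1 m x" "e' \<ominus>\<^bsub>E_mod C2 x\<^esub> g x e \<in> B_sub C2 m x"
    using assms(1) C2.Z_Suc_subset unfolding surj_at_def by blast
  obtain b where b: "C1.drel m x e b"
    using e(1) C1.Z_iff_drel by blast
  have "e' \<ominus>\<^bsub>E_mod C2 x\<^esub> (e' \<ominus>\<^bsub>E_mod C2 x\<^esub> g x e) \<in> Z_sub C2 (Suc m) x"
    using e' e(2) C2.B_subset_Z C2.Z_facts(5) by blast
  then have "g x e \<in> Z_sub C2 (Suc m) x"
    using C2.Z_facts(2)[OF e'] g.closed[OF C1.Z_facts(2)[OF e(1)]] by (simp add: C2.E.diff_diff_self)
  then have "g y b \<in> B_sub C2 m y"
    using C2.drel_cycle_iff[OF drel_map[OF b]] by (simp add: y diff_deg_eq)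
  then have "b \<in> B_sub C1 m y"
    using assms(2) C1.drel_in_Z[OF b] unfolding inj_at_def y by blast
  then have "e \<in> Z_sub C1 (Suc m) x"
    using C1.drel_cycle_iff[OF b] by (simp add: y)
  then show "\<exists>e\<in>Z_sub C1 (Suc m) x. e' \<ominus>\<^bsub>E_mod C2 x\<^esub> g x e \<in> B_sub C2 (Suc m) x"
    using e(2) C2.B_Suc_supset by blast
qed

text \<open>
  Where every element on the page of the second couple is a cycle, the next page is a cokernel, and
  surjectivity on the cokernel and on the source of the differential gives surjectivity on the page.
\<close>

lemma surj_at_descend:
  assumes "surj_at (Suc m) y" and "surj_at m x" and "Z_sub C2 (Suc m) y = Z_sub C2 m y"
  shows "surj_at m y"
  unfolding surj_at_def
proof
  fix e' assume e': "e' \<in> Z_sub C2 m y"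
  then obtain e where e: "e \<in> Z_sub C1 (Suc m) y" "e' \<ominus>\<^bsub>E_mod C2 y\<^esub> g y e \<in> B_sub C2 (Suc m) y"
    using assms(1,3) unfolding surj_at_def by blast
  obtain b where b: "b \<in> B_sub C1 (Suc m) y"
    "(e' \<ominus>\<^bsub>E_mod C2 y\<^esub> g y e) \<ominus>\<^bsub>E_mod C2 y\<^esub> g y b \<in> B_sub C2 m y"
    using lift_boundary[OF assms(2) e(2)] by blast
  have Z: "e \<in> Z_sub C1 m y" "b \<in> Z_sub C1 m y"
    using e(1) C1.Z_Suc_subset b(1) C1.B_subset_Z by blast+
  note carr = Z[THEN C1.Z_facts(2)]
  have "e' \<ominus>\<^bsub>E_mod C2 y\<^esub> g y (e \<oplus>\<^bsub>E_mod C1 y\<^esub> b) \<in> B_sub C2 m y"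
    using b(2) C2.Z_facts(2)[OF e'] by (simp add: g.add carr g.closed C2.E.diff_diff_add)
  then show "\<exists>e\<in>Z_sub C1 m y. e' \<ominus>\<^bsub>E_mod C2 y\<^esub> g y e \<in> B_sub C2 m y"
    using C1.Z_facts(4)[OF Z] by blast
qed

text \<open>
  The image of \<open>e\<close> is a cycle, so on page \<open>m + 2\<close> it is hit by some \<open>e1\<close>.  The error is a boundary, which lifts
  to a boundary \<open>b\<close>.  Then \<open>e - e1 - b\<close> maps to \<open>0\<close> on page \<open>m + 1\<close>, hence is \<open>0\<close> there, and \<open>e\<close> differs from
  the cycle \<open>e1 + b\<close> only by an element of \<open>B\<^sub>m\<close>.
\<close>

lemma reflect_cycle:
  assumes "inj_at m y" and "surj_at (Suc m) y" and "surj_at m x"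
    and "e \<in> Z_sub C1 m y" and "g y e \<in> Z_sub C2 (Suc m) y"
  shows "e \<in> Z_sub C1 (Suc m) y"
proof -
  obtain e1 where e1: "e1 \<in> Z_sub C1 (Suc m) y" "g y e \<ominus>\<^bsub>E_mod C2 y\<^esub> g y e1 \<in> B_sub C2 (Suc m) y"
    using assms(2,5) unfolding surj_at_def by blast
  obtain b where b: "b \<in> B_sub C1 (Suc m) y"
    "(g y e \<ominus>\<^bsub>E_mod C2 y\<^esub> g y e1) \<ominus>\<^bsub>E_mod C2 y\<^esub> g y b \<in> B_sub C2 m y"
    using lift_boundary[OF assms(3) e1(2)] by blast
  have bZ: "b \<in> Z_sub C1 (Suc m) y"
    using b(1) C1.B_subset_Z by blast
  let ?s = "e1 \<oplus>\<^bsub>E_mod C1 y\<^esub> b"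
  have s: "?s \<in> Z_sub C1 (Suc m) y"
    using e1(1) bZ by (rule C1.Z_facts(4))
  note carr = C1.Z_facts(2)[OF assms(4)] C1.Z_facts(2)[OF e1(1)] C1.Z_facts(2)[OF bZ]
  have "g y (e \<ominus>\<^bsub>E_mod C1 y\<^esub> ?s) \<in> B_sub C2 m y"
    using b(2) by (simp add: g.diff g.add carr g.closed C2.E.diff_diff_add)
  moreover have "e \<ominus>\<^bsub>E_mod C1 y\<^esub> ?s \<in> Z_sub C1 m y"
    using assms(4) s C1.Z_Suc_subset C1.Z_facts(5) by blast
  ultimately have "e \<ominus>\<^bsub>E_mod C1 y\<^esub> ?s \<in> Z_sub C1 (Suc m) y"
    using assms(1) C1.B_subset_Z unfolding inj_at_def by blast
  then have "(e \<ominus>\<^bsub>E_mod C1 y\<^esub> ?s) \<oplus>\<^bsub>E_mod C1 y\<^esub> ?s \<in> Z_sub C1 (Suc m) y"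
    using s by (rule C1.Z_facts(4))
  then show ?thesis
    using carr by (simp add: C1.E.diff_add_cancel)
qed

end

text \<open>
  The injective half of the same five lemma, at a position \<open>z\<close> where all elements on the page of the first
  couple are cycles.  If \<open>b\<close> maps to \<open>0\<close> on page \<open>m + 1\<close>, it does so on page \<open>m + 2\<close> too, and by injectivity
  there \<open>b = d e\<close> with \<open>e\<close> at \<open>y\<close>.  The image of \<open>e\<close> is then a cycle, hence so is \<open>e\<close>, and \<open>b\<close> is zero on
  page \<open>m + 1\<close>.
\<close>

lemma inj_at_descend:
  assumes y: "y = x + diff_deg C1 (Suc m)" and z: "z = y + diff_deg C1 (Suc m)"
    and "inj_at m y" and "surj_at (Suc m) y" and "surj_at m x"
    and "inj_at (Suc m) z" and "Z_sub C1 (Suc m) z = Z_sub C1 m z"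
  shows "inj_at m z"
  unfolding inj_at_def
proof (intro ballI impI)
  fix b assume b: "b \<in> Z_sub C1 m z" "g z b \<in> B_sub C2 m z"
  have "b \<in> B_sub C1 (Suc m) z"
    using assms(6,7) b C2.B_Suc_supset unfolding inj_at_def by blast
  then obtain e where e: "C1.drel m y e b"
    using C1.boundary_is_drel_value unfolding z by blast
  have "g y e \<in> Z_sub C2 (Suc m) y"
    using C2.drel_cycle_iff[OF drel_map[OF e]] b(2) by (simp add: z diff_deg_eq)
  then have "e \<in> Z_sub C1 (Suc m) y"
    using reflect_cycle[OF y assms(3,4,5)] C1.drel_domain[OF e] by blast
  then show "b \<in> B_sub C1 m z"
    using C1.drel_cycle_iff[OF e] by (simp add: z)
qed

end


section \<open>First quadrant exact couples and their limit abutment\<close>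

lemma INT_stationary:
  fixes A :: "nat \<Rightarrow> 'a set"
  assumes "\<And>k. A (Suc k) \<subseteq> A k" and "\<And>k. m \<le> k \<Longrightarrow> A (Suc k) = A k"
  shows "(\<Inter>k. A k) = A m"
proof -
  have "A m \<subseteq> A k" for k
  proof (cases "m \<le> k")
    case True
    then show ?thesis
      using assms(2) by (induction k rule: dec_induct) auto
  next
    case False
    then show ?thesis
      using lift_Suc_antimono_le[of A, OF assms(1)] by simp
  qed
  then show ?thesis
    by blast
qed

lemma UN_stationary:
  fixes A :: "nat \<Rightarrow> 'a set"
  assumes "\<And>k. A k \<subseteq> A (Suc k)" and "\<And>k. m \<le> k \<Longrightarrow> A (Suc k) = A k"
  shows "(\<Union>k. A k) = A m"
proof -
  have "A k \<subseteq> A m" for k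
  proof (cases "m \<le> k")
    case True
    then show ?thesis
      using assms(2) by (induction k rule: dec_induct) auto
  next
    case False
    then show ?thesis
      using lift_Suc_mono_le[of A, OF assms(1)] by simp
  qed
  then show ?thesis
    by blast
qed

text \<open>
  With \<open>d\<^sub>m\<^sub>+\<^sub>1\<close> of bidegree \<open>(m + 1, - m)\<close> in the first quadrant, no differential \<open>d\<^sub>m\<^sub>+\<^sub>1\<close> leaves \<open>(p, q)\<close>
  once \<open>q < m\<close>, and none arrives once \<open>p \<le> m\<close>.  So \<open>Z\<close> and \<open>B\<close> become stationary and \<open>E\<^sub>\<infinity>\<close> is literally a
  page, which makes the statements about pages available at infinity.
\<close>

locale abutting_couple = exact_couple_loc R C
  for R :: "('r, 'm) ring_scheme" and C :: "('r, 'd, 'e) couple" +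
  fixes t :: int and \<pi> :: "pos \<Rightarrow> (pos \<Rightarrow> 'd) \<Rightarrow> 'e set"
  assumes quadrant: "first_quadrant C" and cohomological: "cohomological C"
    and matches: "matches_limit_abut R C t \<pi>"
begin

lemma diff_deg_Suc: "1 \<le> m \<Longrightarrow> diff_deg C (Suc m) = (int m + 1, - int m)"
  using cohomological by (auto simp: cohomological_def)

lemma zero_page: "1 \<le> m \<Longrightarrow> p < 0 \<or> q < 0 \<Longrightarrow> zero_module (page C (Suc m) (p, q))"
  using quadrant[unfolded first_quadrant_def, rule_format, of "Suc m" p q] by simp

lemma Z_stationary: "1 \<le> m \<Longrightarrow> q < int m \<Longrightarrow> Z_sub C (Suc m) (p, q) = Z_sub C m (p, q)"
  by (rule stationary_Z) (simp add: diff_deg_Suc zero_page)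

lemma B_stationary:
  assumes "1 \<le> m" "p \<le> int m"
  shows "B_sub C (Suc m) (p, q) = B_sub C m (p, q)"
proof -
  have "zero_module (page C (Suc m) (p - (int m + 1), q + int m))"
    using assms by (intro zero_page) auto
  from stationary_B[OF this] show ?thesis
    using assms(1) by (simp add: diff_deg_Suc)
qed

lemma Z_infinity: "1 \<le> m \<Longrightarrow> q < int m \<Longrightarrow> (\<Inter>r. Z_sub C r (p, q)) = Z_sub C m (p, q)"
  by (rule INT_stationary) (auto intro: Z_Suc_subset[THEN subsetD] simp: Z_stationary)

lemma B_infinity: "1 \<le> m \<Longrightarrow> p \<le> int m \<Longrightarrow> (\<Union>r. B_sub C r (p, q)) = B_sub C m (p, q)"
  by (rule UN_stationary) (auto intro: B_Suc_supset[THEN subsetD] simp: B_stationary)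

lemma E_infinity_eq_page:
  "1 \<le> m \<Longrightarrow> p \<le> int m \<Longrightarrow> q < int m \<Longrightarrow> E_infinity C (p, q) = page C (Suc m) (p, q)"
  by (simp add: E_infinity_def page_Suc Z_infinity B_infinity)

lemma limit_fil_iff:
  "u \<in> limit_fil C t (p, q) \<longleftrightarrow>
    u \<in> carrier (limit_abut C (p + q)) \<and> u (p + t, q - t) = \<zero>\<^bsub>D_mod C (p + t, q - t)\<^esub>"
  by (auto simp: limit_fil_def a_kernel_def')

lemma limit_fil_bottom: "0 \<le> n \<Longrightarrow> limit_fil C t (n, 0) = {\<zero>\<^bsub>limit_abut C n\<^esub>}"
  and limit_fil_top: "0 \<le> n \<Longrightarrow> limit_fil C t (-1, n + 1) = carrier (limit_abut C n)"
  using matches[unfolded matches_limit_abut_def, THEN conjunct2, THEN spec, THEN mp, of n]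
  by simp_all

lemma
  assumes "0 \<le> p" "0 \<le> q"
  shows \<pi>_image: "\<pi> (p, q) ` limit_fil C t (p - 1, q + 1) = carrier (E_infinity C (p, q))"
    and \<pi>_kernel: "u \<in> limit_fil C t (p, q) \<longleftrightarrow>
      u \<in> limit_fil C t (p - 1, q + 1) \<and> \<pi> (p, q) u = \<zero>\<^bsub>E_infinity C (p, q)\<^esub>"
proof -
  let ?F = "(limit_abut C (p + q))\<lparr>carrier := limit_fil C t (p - 1, q + 1)\<rparr>"
  have *: "\<pi> (p, q) ` carrier ?F = carrier (E_infinity C (p, q))"
    "a_kernel ?F (E_infinity C (p, q)) (\<pi> (p, q)) = limit_fil C t (p, q)"
    using matches[unfolded matches_limit_abut_def Let_def, THEN conjunct2, THEN spec, THEN mp,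
        of "p + q", THEN conjunct2, THEN conjunct2, THEN spec, THEN spec, THEN mp, of p q] assms
    by simp_all
  from *(1) show "\<pi> (p, q) ` limit_fil C t (p - 1, q + 1) = carrier (E_infinity C (p, q))"
    by simp
  show "u \<in> limit_fil C t (p, q) \<longleftrightarrow>
      u \<in> limit_fil C t (p - 1, q + 1) \<and> \<pi> (p, q) u = \<zero>\<^bsub>E_infinity C (p, q)\<^esub>"
    using *(2)[symmetric] by (simp add: a_kernel_def')
qed

end


section \<open>Comparison\<close>

locale abutting_map =
  couple_map R C1 C2 f g + C1: abutting_couple R C1 t \<pi>1 + C2: abutting_couple R C2 t \<pi>2
  for R :: "('r, 'm) ring_scheme"
    and C1 :: "('r, 'd1, 'e1) couple" and C2 :: "('r, 'd2, 'e2) couple"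
    and f :: "pos \<Rightarrow> 'd1 \<Rightarrow> 'd2" and g :: "pos \<Rightarrow> 'e1 \<Rightarrow> 'e2"
    and t :: int
    and \<pi>1 :: "pos \<Rightarrow> (pos \<Rightarrow> 'd1) \<Rightarrow> 'e1 set" and \<pi>2 :: "pos \<Rightarrow> (pos \<Rightarrow> 'd2) \<Rightarrow> 'e2 set" +
  assumes compatible: "matching_compatible C1 C2 f g t \<pi>1 \<pi>2"
    and limit_iso: "\<And>n. limit_map f n \<in> lin_iso R (limit_abut C1 n) (limit_abut C2 n)"
begin

lemma E_infinity_map_eq_page_map:
  "1 \<le> m \<Longrightarrow> p \<le> int m \<Longrightarrow> E_infinity_map C2 g (p, q) = page_map C2 g (Suc m) (p, q)"
  by (simp add: E_infinity_map_def page_map_Suc C2.B_infinity)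

lemma inj_at_step:
  assumes "1 \<le> m" "inj_at m (p, q)" "surj_at m (p - (int m + 1), q + int m)"
  shows "inj_at (Suc m) (p, q)"
  using assms by (intro inj_at_Suc[OF _ assms(2,3)]) (simp add: C1.diff_deg_Suc)

lemma surj_at_step:
  assumes "1 \<le> m" "surj_at m (p, q)" "inj_at m (p + (int m + 1), q - int m)"
  shows "surj_at (Suc m) (p, q)"
  using assms by (intro surj_at_Suc[OF _ assms(2,3)]) (simp add: C1.diff_deg_Suc)

lemma limit_map_fil:
  assumes "u \<in> limit_fil C1 t (p, q)"
  shows "limit_map f (p + q) u \<in> limit_fil C2 t (p, q)"
proof -
  have "limit_map f (p + q) u \<in> carrier (limit_abut C2 (p + q))"
    using assms limit_iso[of "p + q"] by (auto simp: C1.limit_fil_iff lin_iso_def lin_hom_def)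
  moreover have "limit_map f (p + q) u (p + t, q - t) = \<zero>\<^bsub>D_mod C2 (p + t, q - t)\<^esub>"
    using assms by (simp add: C1.limit_fil_iff limit_map_def diagonal_def f.zero)
  ultimately show ?thesis
    by (simp add: C2.limit_fil_iff)
qed

lemma page_map_zero: "page_map C2 g (Suc m) x \<zero>\<^bsub>page C1 (Suc m) x\<^esub> = \<zero>\<^bsub>page C2 (Suc m) x\<^esub>"
proof -
  have "B_sub C1 m x = B_sub C1 m x +>\<^bsub>E_mod C1 x\<^esub> \<zero>\<^bsub>E_mod C1 x\<^esub>"
    by (simp add: C1.E.coset_zero[OF C1.B_submodule])
  also have "page_map C2 g (Suc m) x \<dots> = B_sub C2 m x"
    by (simp add: page_map_coset g.zero C2.E.coset_zero[OF C2.B_submodule])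
  finally show ?thesis
    by (simp add: C1.page_Suc C2.page_Suc C1.E.subquotient_zero C2.E.subquotient_zero)
qed

lemma zero_in_page: "\<zero>\<^bsub>page C1 (Suc m) x\<^esub> \<in> carrier (page C1 (Suc m) x)"
proof -
  have "B_sub C1 m x = B_sub C1 m x +>\<^bsub>E_mod C1 x\<^esub> \<zero>\<^bsub>E_mod C1 x\<^esub>"
    by (simp add: C1.E.coset_zero[OF C1.B_submodule])
  then show ?thesis
    using C1.Z_facts(3) unfolding C1.page_Suc C1.E.subquotient_zero C1.E.subquotient_carrier by blast
qed

lemma inj_at_iff_kernel:
  "inj_at m x \<longleftrightarrow> (\<forall>X\<in>carrier (page C1 (Suc m) x).
    page_map C2 g (Suc m) x X = \<zero>\<^bsub>page C2 (Suc m) x\<^esub> \<longrightarrow> X = \<zero>\<^bsub>page C1 (Suc m) x\<^esub>)" (is "_ \<longleftrightarrow> ?ker")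
proof
  show ?ker if "inj_at m x"
    using that page_map_zero zero_in_page unfolding page_map_inj_iff[symmetric] inj_on_def by metis
  show "inj_at m x" if ?ker
    unfolding inj_at_def
  proof (intro ballI impI)
    fix e assume e: "e \<in> Z_sub C1 m x" "g x e \<in> B_sub C2 m x"
    note ce = C1.Z_facts(2)[OF e(1)]
    have "page_map C2 g (Suc m) x (B_sub C1 m x +>\<^bsub>E_mod C1 x\<^esub> e) = B_sub C2 m x"
      using e(2) ce C2.E.coset_eq_self_iff[OF C2.B_submodule] by (simp add: page_map_coset g.closed)
    moreover have "B_sub C1 m x +>\<^bsub>E_mod C1 x\<^esub> e \<in> carrier (page C1 (Suc m) x)"
      using e(1) unfolding C1.page_Suc C1.E.subquotient_carrier by blast
    ultimately have "B_sub C1 m x +>\<^bsub>E_mod C1 x\<^esub> e = B_sub C1 m x"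
      using that by (simp add: C1.page_Suc C2.page_Suc C1.E.subquotient_zero C2.E.subquotient_zero)
    then show "e \<in> B_sub C1 m x"
      using C1.E.coset_eq_self_iff[OF C1.B_submodule ce] by simp
  qed
qed

context
  fixes n :: nat
  assumes columns: "\<And>p q. p \<le> int n \<Longrightarrow> inj_at 1 (p, q) \<and> surj_at 1 (p, q)"
begin

text \<open>
  If the second pages agree in the columns \<open>\<le> n\<close>, then on later pages injectivity persists in all these
  columns, because incoming differentials start further left.  Surjectivity recedes, because outgoing
  differentials must end in a column \<open>\<le> n\<close>.
\<close>

lemma columns_all_pages:
  assumes "1 \<le> m"
  shows "(p \<le> int n \<longrightarrow> inj_at m (p, q)) \<and> (p \<le> int n - int m \<longrightarrow> surj_at m (p, q))"
  using assms
proof (induction m arbitrary: p q rule: dec_induct)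
  case base
  then show ?case
    using columns by simp
next
  case (step m)
  show ?case
    using step.IH[of p q] step.IH[of "p - (int m + 1)" "q + int m"]
      step.IH[of "p + (int m + 1)" "q - int m"] step.hyps
      inj_at_step[of m p q] surj_at_step[of m p q]
    by auto
qed

lemma columns_inj: "1 \<le> m \<Longrightarrow> p \<le> int n \<Longrightarrow> inj_at m (p, q)"
  and columns_surj: "1 \<le> m \<Longrightarrow> p \<le> int n - int m \<Longrightarrow> surj_at m (p, q)"
  using columns_all_pages by blast+

text \<open>
  Every filtration step of the second abutment down to \<open>F\<^sup>n\<close> consists of images of the corresponding step
  of the first.  The top step is the abutment itself, and passing from one step to the next keeps the
  property because the map of the quotients \<open>E\<^sub>\<infinity>\<close> is injective in the columns \<open>\<le> n\<close>.
\<close>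

lemma fil_lift:
  assumes "p \<le> Suc n" "0 \<le> N" "int p \<le> N + 1" "v \<in> limit_fil C2 t (int p - 1, N - int p + 1)"
  shows "\<exists>u\<in>limit_fil C1 t (int p - 1, N - int p + 1). limit_map f N u = v"
  using assms
proof (induction p arbitrary: v)
  case 0
  then have "v \<in> carrier (limit_abut C2 N)"
    using C2.limit_fil_top[of N] by simp
  then show ?case
    using limit_iso[of N] 0 C1.limit_fil_top[of N] by (force simp: lin_iso_def bij_betw_def)
next
  case (Suc p)
  let ?q = "N - int p"
  have pq: "0 \<le> int p" "0 \<le> ?q" "int p + ?q = N"
    using Suc.prems by auto
  \<comment> \<open>Large enough that page \<open>m + 1\<close> is \<open>E\<^sub>\<infinity>\<close> on the whole diagonal \<open>p + q = N\<close>.\<close>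
  define m where "m = nat N + 1"
  have m: "1 \<le> m" "int p \<le> int m" "?q < int m"
    using pq by (auto simp: m_def)
  have "v \<in> limit_fil C2 t (int p, ?q)"
    using Suc.prems(4) by simp
  then have v: "v \<in> limit_fil C2 t (int p - 1, ?q + 1)" "\<pi>2 (int p, ?q) v = \<zero>\<^bsub>E_infinity C2 (int p, ?q)\<^esub>"
    using C2.\<pi>_kernel[OF pq(1,2)] by auto
  obtain u where u: "u \<in> limit_fil C1 t (int p - 1, ?q + 1)" "limit_map f N u = v"
    using Suc.IH[of v] Suc.prems v(1) by auto
  have "E_infinity_map C2 g (int p, ?q) (\<pi>1 (int p, ?q) u) = \<zero>\<^bsub>E_infinity C2 (int p, ?q)\<^esub>"
    using compatible u v(2) pq unfolding matching_compatible_def by metis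
  moreover have "\<pi>1 (int p, ?q) u \<in> carrier (E_infinity C1 (int p, ?q))"
    using u(1) C1.\<pi>_image[OF pq(1,2)] by blast
  moreover have "inj_at m (int p, ?q)"
    using m(1) Suc.prems(1) by (intro columns_inj) auto
  ultimately have "\<pi>1 (int p, ?q) u = \<zero>\<^bsub>E_infinity C1 (int p, ?q)\<^esub>"
    using m by (simp add: E_infinity_map_eq_page_map C1.E_infinity_eq_page C2.E_infinity_eq_page
        inj_at_iff_kernel)
  then have "u \<in> limit_fil C1 t (int p, ?q)"
    using u(1) C1.\<pi>_kernel[OF pq(1,2)] by blast
  then show ?case
    using u(2) by auto
qed

text \<open>
  \<open>E\<^sub>\<infinity>\<^sup>p\<^sup>,\<^sup>q\<close> is a quotient of \<open>F\<^sup>p\<^sup>-\<^sup>1\<^sup>,\<^sup>q\<^sup>+\<^sup>1\<close>, so surjectivity on the filtration step gives it on \<open>E\<^sub>\<infinity>\<close>, one column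
  beyond the hypothesis.
\<close>

lemma infinity_surj:
  assumes "p \<le> Suc n" "0 \<le> q" "1 \<le> m" "p \<le> m" "q < int m"
  shows "surj_at m (int p, q)"
  unfolding page_map_surj_iff[symmetric]
proof
  show "page_map C2 g (Suc m) (int p, q) ` carrier (page C1 (Suc m) (int p, q))
      \<subseteq> carrier (page C2 (Suc m) (int p, q))"
    using lin_hom_closed[OF page_map_hom] by blast
  have m: "1 \<le> m" "int p \<le> int m" "q < int m"
    using assms by auto
  show "carrier (page C2 (Suc m) (int p, q))
      \<subseteq> page_map C2 g (Suc m) (int p, q) ` carrier (page C1 (Suc m) (int p, q))"
  proof
    fix X assume "X \<in> carrier (page C2 (Suc m) (int p, q))"
    then obtain v where v: "v \<in> limit_fil C2 t (int p - 1, q + 1)" "\<pi>2 (int p, q) v = X"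
      using C2.\<pi>_image[of "int p" q, symmetric] assms(2)
      unfolding C2.E_infinity_eq_page[OF m, symmetric] by auto
    obtain u where u: "u \<in> limit_fil C1 t (int p - 1, q + 1)" "limit_map f (int p + q) u = v"
      using fil_lift[of p "int p + q" v] assms(1,2) v(1) by auto
    have "E_infinity_map C2 g (int p, q) (\<pi>1 (int p, q) u) = X"
      using compatible u v(2) assms(2) unfolding matching_compatible_def
      by (metis of_nat_0_le_iff)
    moreover have "\<pi>1 (int p, q) u \<in> carrier (E_infinity C1 (int p, q))"
      using u(1) C1.\<pi>_image[of "int p" q] assms(2) by auto
    ultimately show "X \<in> page_map C2 g (Suc m) (int p, q) ` carrier (page C1 (Suc m) (int p, q))"
      using E_infinity_map_eq_page_map[OF m(1,2)] C1.E_infinity_eq_page[OF m] by auto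
  qed
qed

end

text \<open>
  Since \<open>F\<^sup>p\<^sup>,\<^sup>0 = 0\<close>, the object \<open>E\<^sub>\<infinity>\<^sup>p\<^sup>,\<^sup>0\<close> is isomorphic to \<open>F\<^sup>p\<^sup>-\<^sup>1\<^sup>,\<^sup>1\<close>, a submodule of the abutment, and there
  the map is injective.
\<close>

lemma infinity_inj_bottom:
  fixes p :: nat
  assumes "1 \<le> m" "p \<le> m"
  shows "inj_at m (int p, 0)"
  unfolding inj_at_iff_kernel
proof (intro ballI impI)
  have m: "1 \<le> m" "int p \<le> int m" "0 < int m"
    using assms by auto
  fix X assume X: "X \<in> carrier (page C1 (Suc m) (int p, 0))"
    "page_map C2 g (Suc m) (int p, 0) X = \<zero>\<^bsub>page C2 (Suc m) (int p, 0)\<^esub>"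
  then obtain u where u: "u \<in> limit_fil C1 t (int p - 1, 0 + 1)" "\<pi>1 (int p, 0) u = X"
    using C1.\<pi>_image[of "int p" 0, symmetric]
    unfolding C1.E_infinity_eq_page[OF m, symmetric] by auto
  let ?L1 = "limit_abut C1 (int p)" and ?L2 = "limit_abut C2 (int p)"
  let ?z = "\<zero>\<^bsub>?L1\<^esub>"
  have "\<pi>2 (int p, 0) (limit_map f (int p) u) = E_infinity_map C2 g (int p, 0) X"
    using compatible u unfolding matching_compatible_def
    by (metis add.right_neutral of_nat_0_le_iff order_refl)
  also have "\<dots> = \<zero>\<^bsub>E_infinity C2 (int p, 0)\<^esub>"
    using X(2) E_infinity_map_eq_page_map[OF m(1,2)] C2.E_infinity_eq_page[OF m] by simp
  finally have "limit_map f (int p) u \<in> limit_fil C2 t (int p, 0)"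
    using C2.\<pi>_kernel[of "int p" 0] limit_map_fil[OF u(1)] by simp
  then have "limit_map f (int p) u = \<zero>\<^bsub>?L2\<^esub>"
    using C2.limit_fil_bottom[of "int p"] by simp
  also have "\<dots> = limit_map f (int p) ?z"
    by (auto simp: limit_map_def limit_abut_def f.zero)
  finally have eq: "limit_map f (int p) u = limit_map f (int p) ?z" .
  have z: "?z \<in> limit_fil C1 t (int p, 0)"
    using C1.limit_fil_bottom[of "int p"] by simp
  have "u \<in> carrier ?L1" "?z \<in> carrier ?L1"
    using u(1) z by (auto simp: C1.limit_fil_iff)
  then have "u = ?z"
    using eq limit_iso[of "int p"] by (auto simp: lin_iso_def bij_betw_def inj_on_def)
  then have "\<pi>1 (int p, 0) u = \<zero>\<^bsub>E_infinity C1 (int p, 0)\<^esub>"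
    using z C1.\<pi>_kernel[of "int p" 0] by simp
  then show "X = \<zero>\<^bsub>page C1 (Suc m) (int p, 0)\<^esub>"
    using u(2) C1.E_infinity_eq_page[OF m] by simp
qed

text \<open>
  The map is bijective on \<open>E\<^sub>\<infinity>\<close> at \<open>(n + 1, 0)\<close>, and it remains to go back from page to page.  Nothing
  leaves the bottom row, so \<open>E\<^sub>m\<^sub>+\<^sub>2\<close> there is the cokernel of the differential from \<open>(n - m, m)\<close>, and the
  descent lemmas apply once surjectivity on \<open>E\<^sub>m\<^sub>+\<^sub>2\<close> at \<open>(n - m, m)\<close> is known.  This too comes down from
  \<open>E\<^sub>\<infinity>\<close>, since no differential leaves \<open>(n - m, m)\<close> from that page on.
\<close>

lemma bottom_row_step:
  fixes n :: nat
  assumes columns: "\<And>p q. p \<le> int n \<Longrightarrow> inj_at 1 (p, q) \<and> surj_at 1 (p, q)"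
  shows "inj_at 1 (int n + 1, 0) \<and> surj_at 1 (int n + 1, 0)"
proof -
  \<comment> \<open>The source of the differential that hits \<open>(n + 1, 0)\<close> on page \<open>m + 1\<close>, seen one page later.\<close>
  have edge_surj: "surj_at (Suc m) (int n - int m, int m)" if m: "1 \<le> m" "m \<le> n" for m
  proof -
    \<comment> \<open>Exceeds \<open>m\<close> and \<open>n - m\<close>, so page \<open>K + 1\<close> is \<open>E\<^sub>\<infinity>\<close> at \<open>(n - m, m)\<close>.\<close>
    define K where "K = n + m + 1"
    have "Suc m \<le> K"
      by (simp add: K_def)
    then show ?thesis
    proof (induction rule: inc_induct)
      case base
      have "surj_at K (int (n - m), int m)"
        by (intro infinity_surj[OF columns]) (auto simp: K_def)
      then show ?case
        using m(2) by (simp add: of_nat_diff)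
    next
      case (step k)
      have k: "1 \<le> k"
        using step.hyps by simp
      show ?case
      proof (rule surj_at_descend[OF _ step.IH])
        show "surj_at k (int n - int m - (int k + 1), int m + int k)"
          using k by (intro columns_surj[OF columns]) auto
        show "Z_sub C2 (Suc k) (int n - int m, int m) = Z_sub C2 k (int n - int m, int m)"
          using step.hyps by (intro C2.Z_stationary) auto
      qed (simp add: C1.diff_deg_Suc[OF k])
    qed
  qed
  have "1 \<le> Suc n"
    by simp
  then show ?thesis
  proof (induction rule: inc_induct)
    case base
    have "surj_at (Suc n) (int (Suc n), 0)"
      by (intro infinity_surj[OF columns]) auto
    moreover have "inj_at (Suc n) (int (Suc n), 0)"
      by (intro infinity_inj_bottom) auto
    ultimately show ?case
      by (simp add: add.commute)
  next
    case (step m)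
    let ?y = "(int n - int m, int m)" and ?z = "(int n + 1, 0::int)"
      and ?x = "(int n - int m - (int m + 1), int m + int m)"
    have m: "1 \<le> m" "m \<le> n"
      using step.hyps by auto
    have y: "?y = ?x + diff_deg C1 (Suc m)" and z: "?z = ?y + diff_deg C1 (Suc m)"
      by (simp_all add: C1.diff_deg_Suc[OF m(1)])
    have "inj_at m ?z"
    proof (rule inj_at_descend[OF y z])
      show "inj_at m ?y"
        using m by (intro columns_inj[OF columns]) auto
      show "surj_at (Suc m) ?y"
        using m by (rule edge_surj)
      show "surj_at m ?x"
        using m by (intro columns_surj[OF columns]) auto
      show "inj_at (Suc m) ?z"
        using step.IH by blast
      show "Z_sub C1 (Suc m) ?z = Z_sub C1 m ?z"
        using m by (intro C1.Z_stationary) auto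
    qed
    moreover have "surj_at m ?z"
    proof (rule surj_at_descend[OF z])
      show "surj_at (Suc m) ?z"
        using step.IH by blast
      show "surj_at m ?y"
        using m by (intro columns_surj[OF columns]) auto
      show "Z_sub C2 (Suc m) ?z = Z_sub C2 m ?z"
        using m by (intro C2.Z_stationary) auto
    qed
    ultimately show ?case
      by blast
  qed
qed

end

theorem theorem2p6p8:
  fixes R :: "('r, 'm) ring_scheme"
    and C1 :: "('r, 'd1, 'e1) couple"
    and C2 :: "('r, 'd2, 'e2) couple"
    and f :: "pos \<Rightarrow> 'd1 \<Rightarrow> 'd2"
    and g :: "pos \<Rightarrow> 'e1 \<Rightarrow> 'e2"
    and t :: int
    and \<pi>1 :: "pos \<Rightarrow> (pos \<Rightarrow> 'd1) \<Rightarrow> 'e1 set"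
    and \<pi>2 :: "pos \<Rightarrow> (pos \<Rightarrow> 'd2) \<Rightarrow> 'e2 set"
  assumes "exact_couple R C1" and "exact_couple R C2"
    and "couple_morphism R C1 C2 f g"
    and "first_quadrant C1" and "first_quadrant C2"
    and "cohomological C1" and "cohomological C2"
    and "matches_limit_abut R C1 t \<pi>1" and "matches_limit_abut R C2 t \<pi>2"
    and "matching_compatible C1 C2 f g t \<pi>1 \<pi>2"
    and "\<And>n. limit_map f n \<in> lin_iso R (limit_abut C1 n) (limit_abut C2 n)"
    and "page_map C2 g 2 (0, 0) \<in> lin_iso R (page C1 2 (0, 0)) (page C2 2 (0, 0))"
    and "\<And>n. \<lbrakk>n \<ge> 0;
            \<And>p. 0 \<le> p \<Longrightarrow> p \<le> n \<Longrightarrow>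
              page_map C2 g 2 (p, 0) \<in> lin_iso R (page C1 2 (p, 0)) (page C2 2 (p, 0))\<rbrakk>
          \<Longrightarrow> \<forall>p q. p \<le> n \<longrightarrow>
              page_map C2 g 2 (p, q) \<in> lin_iso R (page C1 2 (p, q)) (page C2 2 (p, q))"
  shows "ss_isomorphism R C1 C2 (page_map C2 g)"
proof -
  interpret C1: abutting_couple R C1 t \<pi>1
    using assms(1,4,6,8) by unfold_locales
  interpret C2: abutting_couple R C2 t \<pi>2
    using assms(2,5,7,9) by unfold_locales
  interpret abutting_map R C1 C2 f g t \<pi>1 \<pi>2
    using assms(3,10,11) by unfold_locales
  have iso2: "page_map C2 g 2 x \<in> lin_iso R (page C1 2 x) (page C2 2 x) \<longleftrightarrow> inj_at 1 x \<and> surj_at 1 x" for x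
    using page_map_iso_iff[of 1 x] by (simp add: numeral_2_eq_2)
  have columns: "inj_at 1 (p, q) \<and> surj_at 1 (p, q)"
    if "\<And>p. 0 \<le> p \<Longrightarrow> p \<le> int n \<Longrightarrow> inj_at 1 (p, 0) \<and> surj_at 1 (p, 0)" "p \<le> int n" for n p q
    using assms(13)[unfolded iso2, OF of_nat_0_le_iff that(1)] that(2) by blast
  have row: "0 \<le> p \<Longrightarrow> p \<le> int n \<Longrightarrow> inj_at 1 (p, 0) \<and> surj_at 1 (p, 0)" for n p
  proof (induction n arbitrary: p)
    case 0
    then show ?case
      using assms(12)[unfolded iso2] by (metis of_nat_0 order_antisym)
  next
    case (Suc n)
    show ?case
    proof (cases "p \<le> int n")
      case False
      then have "p = int n + 1"
        using Suc.prems by simp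
      then show ?thesis
        using bottom_row_step[OF columns[OF Suc.IH]] by simp
    qed (use Suc in simp)
  qed
  have all2: "inj_at 1 (p, q) \<and> surj_at 1 (p, q)" for p q
    using columns[of "nat p" p q, OF row[of _ "nat p"]] by simp
  have all: "inj_at m (p, q) \<and> surj_at m (p, q)" if "1 \<le> m" for m p q
    using that
  proof (induction m arbitrary: p q rule: dec_induct)
    case (step m)
    then show ?case
      using inj_at_step surj_at_step by blast
  qed (rule all2)
  have "page_map C2 g r x \<in> lin_iso R (page C1 r x) (page C2 r x)" if "2 \<le> r" for r x
  proof -
    obtain m where "r = Suc m" "1 \<le> m"
      using \<open>2 \<le> r\<close> by (cases r) auto
    then show ?thesis
      using all[of m "fst x" "snd x"] by (simp add: page_map_iso_iff)
  qed
  then show ?thesis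
    by (simp add: ss_isomorphism_def page_map_ss_morphism)
qed

end
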